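(* Let $\delta\in\mathbb{R}$ and let $(T_N)_{N\in\mathbb{N}}$ be a sequence with $T_N\in 2\mathbb{N}$, $T_N\le N$, such that $T_\infty:=\lim_{N\to\infty}T_N\in 2\mathbb{N}\cup\{+\infty\}$ exists. Then the limit $$\phi(\delta,(T_N)_N):=\lim_{N\to\infty}\frac1N\log Z^{T_N}_{N,\delta}$$ exists, depends only on $\delta$ and $T_\infty$ (write it $\phi(\delta,T_\infty)$), and is given by $$\phi(\delta,T_\infty)=\begin{cases}(Q_{T_\infty})^{-1}(e^{-\delta}) & \text{if } T_\infty<\infty,\\ (Q_\infty)^{-1}(e^{-\delta}\wedge 1) & \text{if } T_\infty=\infty.\end{cases}$$ Consequently, if $T_\infty<\infty$ then $\delta\mapsto\phi(\delta,T_\infty)$ is real-analytic on all of $\mathbb{R}$, while $\delta\mapsto\phi(\delta,\infty)$ is real-analytic on $\mathbb{R}\setminus\{0\}$ (and, explicitly, $\phi(\delta,\infty)=\big(\frac{\delta}{2}-\log\sqrt{2-e^{-\delta}}\big)\mathbf 1_{\{\delta\ge0\}}$).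
   Context: $(S_n)_{n\ge0}$ is the simple symmetric random walk on $\mathbb{Z}$ started at $S_0=0$, with law $\mathbf P$ and expectation $\mathbf E$. For $T\in 2\mathbb{N}$, $N\in\mathbb{N}$, $\delta\in\mathbb{R}$, set $H^T_{N,\delta}(S):=\delta\sum_{i=1}^N\mathbf 1_{\{S_i\in T\mathbb{Z}\}}$ and $Z^T_{N,\delta}:=\mathbf E[\exp(H^T_{N,\delta}(S))]$. For $T\in2\mathbb{N}\cup\{\infty\}$ let $\tau_1^T:=\inf\{n>0: S_n\in\{-T,0,T\}\}$ (for $T=\infty$, $\tau^\infty_1$ is the first return time to $0$), and $Q_T(\lambda):=\mathbf E[e^{-\lambda\tau_1^T}]\in(0,\infty]$ for $\lambda\in\mathbb{R}$. For $T<\infty$, $Q_T$ is finite, analytic and strictly decreasing on $(\lambda_0^T,\infty)$ where $\lambda_0^T:=-\frac12\log(1+\tan^2(\pi/T))<0$, with $Q_T(\lambda)\to+\infty$ as $\lambda\downarrow\lambda_0^T$ and $Q_T(\lambda)\to0$ as $\lambda\to\infty$; $(Q_T)^{-1}$ denotes its inverse, defined on $(0,\infty)$. For $T=\infty$, $Q_\infty(\lambda)=1-\sqrt{1-e^{-2\lambda}}$ for $\lambda\ge0$ and $Q_\infty(\lambda)=+\infty$ for $\lambda<0$; $(Q_\infty)^{-1}$ denotes its inverse defined on $(0,1]$. *)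

theory Defs
  imports "HOL-Analysis.Analysis"
begin

text \<open>Simple symmetric random walk paths of length n are encoded as bool lists
  of length n (True = step +1, False = step -1), each having probability 2^(-n).\<close>

definition srw_pos :: "bool list \<Rightarrow> nat \<Rightarrow> int" where
  "srw_pos xs i = (\<Sum>j<i. if xs ! j then 1 else -1)"

definition srw_paths :: "nat \<Rightarrow> bool list set" where
  "srw_paths n = {xs. length xs = n}"

definition Zpart :: "nat \<Rightarrow> nat \<Rightarrow> real \<Rightarrow> real" where
  "Zpart T N \<delta> = (\<Sum>xs\<in>srw_paths N.
      exp (\<delta> * real (card {i\<in>{1..N}. int T dvd srw_pos xs i}))) / 2 ^ N"

definition first_hit_at :: "int set \<Rightarrow> bool list \<Rightarrow> nat \<Rightarrow> bool" where
  "first_hit_at A xs n \<longleftrightarrow> 0 < n \<and> srw_pos xs n \<in> A \<and> (\<forall>m\<in>{1..<n}. srw_pos xs m \<notin> A)"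

definition hit_prob :: "int set \<Rightarrow> nat \<Rightarrow> real" where
  "hit_prob A n = real (card {xs\<in>srw_paths n. first_hit_at A xs n}) / 2 ^ n"

text \<open>Laplace transform E[exp(-lambda tau_A)] in [0,\<infinity>] (the event tau = \<infinity> contributes 0).\<close>
definition Qhit :: "int set \<Rightarrow> real \<Rightarrow> ennreal" where
  "Qhit A lam = (\<Sum>n. ennreal (hit_prob A n * exp (- lam * real n)))"

definition Q_fin :: "nat \<Rightarrow> real \<Rightarrow> ennreal" where
  "Q_fin T lam = Qhit {- int T, 0, int T} lam"

definition Q_inf :: "real \<Rightarrow> ennreal" where
  "Q_inf lam = Qhit {0} lam"

definition Q_fin_inv :: "nat \<Rightarrow> real \<Rightarrow> real" where
  "Q_fin_inv T y = (THE lam. Q_fin T lam = ennreal y)"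

definition Q_inf_inv :: "real \<Rightarrow> real" where
  "Q_inf_inv y = (THE lam. Q_inf lam = ennreal y)"

definition phi_fin :: "nat \<Rightarrow> real \<Rightarrow> real" where
  "phi_fin T \<delta> = Q_fin_inv T (exp (- \<delta>))"

definition phi_inf :: "real \<Rightarrow> real" where
  "phi_inf \<delta> = Q_inf_inv (min (exp (- \<delta>)) 1)"

definition real_analytic_on :: "(real \<Rightarrow> real) \<Rightarrow> real set \<Rightarrow> bool" where
  "real_analytic_on f S \<longleftrightarrow> (\<forall>x\<in>S. \<exists>r>0. \<exists>c::nat \<Rightarrow> real.
      \<forall>y. \<bar>y - x\<bar> < r \<longrightarrow> (\<lambda>n. c n * (y - x) ^ n) sums f y)"

end

theory Submission
  imports Defs "HOL-Complex_Analysis.Conformal_Mappings"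
begin

text \<open>
  Let \<open>K\<close> be the one-step operator of the walk weighted by \<open>exp \<delta>\<close> on multiples of \<open>T\<close>, so that
  \<open>Zpart T N \<delta> = (K^N 1) 0\<close>. A positive function \<open>h\<close> with \<open>K h \<le> c h\<close> or \<open>K h \<ge> c h\<close> bounds the
  partition function by a multiple of \<open>c^N\<close>, so growth rates are read off from explicit periodic
  functions. For \<open>T = 2 m\<close> the Chebyshev values \<open>C\<^sub>|\<^sub>m\<^sub>-\<^sub>j\<^sub>| (c)\<close> give a true eigenfunction as soon as
  \<open>c C\<^sub>m(c) = exp \<delta> C\<^sub>m\<^sub>-\<^sub>1(c)\<close>, and the same functions compute the Laplace transform:
  \<open>Q\<^sub>T(ln c) = C\<^sub>m\<^sub>-\<^sub>1(c) / (c C\<^sub>m(c))\<close>. Analyticity follows from the holomorphic inverse function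
  theorem, the derivative being nonzero by a Wronskian recurrence. When \<open>T\<close> grows with \<open>N\<close> the bounds
  have to be uniform in \<open>T\<close>: for \<open>\<delta> \<ge> 0\<close> one uses the maximum (lower bound) and the sum plus a
  constant (upper bound) of \<open>exp (-a j)\<close> and \<open>exp (-a (T - j))\<close>, for \<open>\<delta> \<le> 0\<close> the subsolution
  \<open>j (T - j)\<close> with \<open>c = 1 - 1 / (T - 1)\<close>.
\<close>

section \<open>Path sums and the transfer operator\<close>

definition transfer :: "(int \<Rightarrow> real) \<Rightarrow> (int \<Rightarrow> real) \<Rightarrow> int \<Rightarrow> real" where
  "transfer w f x = (w (x + 1) * f (x + 1) + w (x - 1) * f (x - 1)) / 2"

lemma finite_srw_paths: "finite (srw_paths n)"
  using finite_lists_length_eq[of "UNIV :: bool set" n] by (simp add: srw_paths_def)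

lemma sum_srw_paths_Suc:
  fixes F :: "bool list \<Rightarrow> real"
  shows "(\<Sum>xs\<in>srw_paths (Suc n). F xs)
    = (\<Sum>xs\<in>srw_paths n. F (True # xs)) + (\<Sum>xs\<in>srw_paths n. F (False # xs))"
proof -
  have "srw_paths (Suc n) = Cons True ` srw_paths n \<union> Cons False ` srw_paths n"
  proof -
    have "xs \<in> Cons True ` srw_paths n \<union> Cons False ` srw_paths n" if "length xs = Suc n" for xs
      using that by (cases xs) (auto simp: srw_paths_def image_iff)
    thus ?thesis by (auto simp: srw_paths_def)
  qed
  moreover have "(\<Sum>xs\<in>Cons True ` srw_paths n \<union> Cons False ` srw_paths n. F xs)
      = (\<Sum>xs\<in>Cons True ` srw_paths n. F xs) + (\<Sum>xs\<in>Cons False ` srw_paths n. F xs)"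
    by (intro sum.union_disjoint) (auto simp: finite_srw_paths)
  ultimately show ?thesis by (simp add: sum.reindex)
qed

lemma srw_pos_0 [simp]: "srw_pos xs 0 = 0"
  by (simp add: srw_pos_def)

lemma srw_pos_Cons:
  "x + srw_pos (True # xs) (Suc i) = (x + 1) + srw_pos xs i"
  "x + srw_pos (False # xs) (Suc i) = (x - 1) + srw_pos xs i"
  unfolding srw_pos_def by (simp_all add: sum.lessThan_Suc_shift del: sum.lessThan_Suc)

lemma prod_atLeast1_Suc_shift:
  fixes g :: "nat \<Rightarrow> real"
  shows "(\<Prod>i\<in>{1..Suc n}. g i) = g 1 * (\<Prod>i\<in>{1..n}. g (Suc i))"
proof -
  have "(\<Prod>i\<in>{1..Suc n}. g i) = g 1 * (\<Prod>i\<in>{Suc 1..Suc n}. g i)"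
    by (subst prod.atLeast_Suc_atMost) auto
  thus ?thesis by (simp only: prod.shift_bounds_cl_Suc_ivl)
qed

lemma path_sum_eq_transfer:
  "(\<Sum>xs\<in>srw_paths n. (\<Prod>i\<in>{1..n}. w (x + srw_pos xs i)) * f (x + srw_pos xs n)) / 2 ^ n
    = (transfer w ^^ n) f x"
proof (induction n arbitrary: x)
  case 0
  show ?case by (simp add: srw_paths_def)
next
  case (Suc n)
  define S where "S x = (\<Sum>xs\<in>srw_paths n.
    (\<Prod>i\<in>{1..n}. w (x + srw_pos xs i)) * f (x + srw_pos xs n))" for x
  have IH: "S y = 2 ^ n * (transfer w ^^ n) f y" for y
    using Suc.IH[of y] unfolding S_def by (simp add: field_simps)
  have "(\<Sum>xs\<in>srw_paths (Suc n).
      (\<Prod>i\<in>{1..Suc n}. w (x + srw_pos xs i)) * f (x + srw_pos xs (Suc n)))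
      = w (x + 1) * S (x + 1) + w (x - 1) * S (x - 1)"
    unfolding sum_srw_paths_Suc prod_atLeast1_Suc_shift S_def
    by (simp add: srw_pos_Cons sum_distrib_left mult.assoc)
  thus ?case by (simp add: IH transfer_def[of w "(transfer w ^^ n) f"] field_simps)
qed

lemma first_hit_sum_eq_transfer:
  "(\<Sum>xs\<in>srw_paths (Suc n). (\<Prod>i\<in>{1..n}. w (x + srw_pos xs i)) * f (x + srw_pos xs (Suc n)))
      / 2 ^ Suc n
    = (transfer w ^^ n) (transfer (\<lambda>_. 1) f) x"
proof (induction n arbitrary: x)
  case 0
  have "srw_paths 0 = {[]}" by (auto simp: srw_paths_def)
  thus ?case unfolding sum_srw_paths_Suc by (simp add: srw_pos_Cons transfer_def)
next
  case (Suc n)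
  define S where "S x = (\<Sum>xs\<in>srw_paths (Suc n).
    (\<Prod>i\<in>{1..n}. w (x + srw_pos xs i)) * f (x + srw_pos xs (Suc n)))" for x
  have IH: "S y = 2 ^ Suc n * (transfer w ^^ n) (transfer (\<lambda>_. 1) f) y" for y
    using Suc.IH[of y] unfolding S_def by (simp add: field_simps)
  have "(\<Sum>xs\<in>srw_paths (Suc (Suc n)).
      (\<Prod>i\<in>{1..Suc n}. w (x + srw_pos xs i)) * f (x + srw_pos xs (Suc (Suc n))))
      = w (x + 1) * S (x + 1) + w (x - 1) * S (x - 1)"
    unfolding sum_srw_paths_Suc[of _ "Suc n"] prod_atLeast1_Suc_shift S_def
    by (simp add: srw_pos_Cons sum_distrib_left mult.assoc)
  thus ?case
    by (simp add: IH transfer_def[of w "(transfer w ^^ n) (transfer (\<lambda>_. 1) f)"] field_simps)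
qed

definition pin_weight :: "real \<Rightarrow> nat \<Rightarrow> int \<Rightarrow> real" where
  "pin_weight \<delta> T x = (if int T dvd x then exp \<delta> else 1)"

lemma Zpart_eq_transfer: "Zpart T N \<delta> = (transfer (pin_weight \<delta> T) ^^ N) (\<lambda>_. 1) 0"
proof -
  have "exp (\<delta> * real (card {i\<in>{1..N}. int T dvd srw_pos xs i}))
      = (\<Prod>i\<in>{1..N}. pin_weight \<delta> T (srw_pos xs i))" for xs
  proof -
    have "(\<Prod>i\<in>{1..N}. pin_weight \<delta> T (srw_pos xs i))
        = (\<Prod>i\<in>{i\<in>{1..N}. int T dvd srw_pos xs i}. exp \<delta>)"
      unfolding pin_weight_def by (intro prod.inter_filter[symmetric]) simp
    thus ?thesis by (simp add: exp_of_nat_mult[symmetric] mult.commute)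
  qed
  thus ?thesis
    using path_sum_eq_transfer[where w = "pin_weight \<delta> T" and x = 0 and f = "\<lambda>_. 1"]
    by (simp add: Zpart_def)
qed

definition avoid :: "int set \<Rightarrow> int \<Rightarrow> real" where
  "avoid A x = (if x \<in> A then 0 else 1)"

lemma hit_prob_0 [simp]: "hit_prob A 0 = 0"
  by (simp add: hit_prob_def first_hit_at_def)

lemma hit_prob_nonneg: "hit_prob A n \<ge> 0"
  by (simp add: hit_prob_def)

lemma hit_prob_Suc:
  "hit_prob A (Suc n) = (transfer (avoid A) ^^ n) (transfer (\<lambda>_. 1) (indicator A)) 0"
proof -
  have "(\<Prod>i\<in>{1..n}. avoid A (srw_pos xs i)) * indicator A (srw_pos xs (Suc n))
      = (if first_hit_at A xs (Suc n) then 1 else 0 :: real)" for xs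
  proof (cases "\<forall>i\<in>{1..n}. srw_pos xs i \<notin> A")
    case True
    hence "(\<Prod>i\<in>{1..n}. avoid A (srw_pos xs i)) = 1"
      by (intro prod.neutral) (auto simp: avoid_def)
    moreover have "first_hit_at A xs (Suc n) \<longleftrightarrow> srw_pos xs (Suc n) \<in> A"
      using True by (auto simp: first_hit_at_def)
    ultimately show ?thesis by (simp add: indicator_def)
  next
    case False
    hence "(\<Prod>i\<in>{1..n}. avoid A (srw_pos xs i)) = 0"
      by (intro prod_zero) (auto simp: avoid_def)
    moreover have "\<not> first_hit_at A xs (Suc n)"
      using False by (auto simp: first_hit_at_def)
    ultimately show ?thesis by simp
  qed
  moreover have "real (card {xs\<in>srw_paths (Suc n). first_hit_at A xs (Suc n)})
      = (\<Sum>xs\<in>srw_paths (Suc n). if first_hit_at A xs (Suc n) then 1 else 0)"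
    by (simp add: sum.inter_filter[symmetric] finite_srw_paths)
  ultimately show ?thesis
    using first_hit_sum_eq_transfer[where w = "avoid A" and x = 0 and f = "indicator A" and n = n]
    by (simp only: hit_prob_def add_0)
qed

definition step_closed :: "(int \<Rightarrow> real) \<Rightarrow> int set \<Rightarrow> bool" where
  "step_closed w D \<longleftrightarrow> (\<forall>x. w x \<ge> 0) \<and>
     (\<forall>x\<in>D. (w (x + 1) \<noteq> 0 \<longrightarrow> x + 1 \<in> D) \<and> (w (x - 1) \<noteq> 0 \<longrightarrow> x - 1 \<in> D))"

lemma transfer_mono:
  assumes "step_closed w D" "\<And>x. x \<in> D \<Longrightarrow> f x \<le> g x" "x \<in> D"
  shows "transfer w f x \<le> transfer w g x"
proof -
  have "w y * f y \<le> w y * g y" if "y = x + 1 \<or> y = x - 1" for y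
    using that assms unfolding step_closed_def
    by (cases "w y = 0") (auto intro!: mult_left_mono)
  thus ?thesis unfolding transfer_def by (intro divide_right_mono add_mono) auto
qed

lemma transfer_funpow_mono:
  assumes "step_closed w D" "\<And>x. x \<in> D \<Longrightarrow> f x \<le> g x" "x \<in> D"
  shows "(transfer w ^^ n) f x \<le> (transfer w ^^ n) g x"
  using assms(3)
proof (induction n arbitrary: x)
  case (Suc n)
  show ?case using transfer_mono[OF assms(1) Suc.IH Suc.prems] by simp
qed (use assms in auto)

lemma transfer_scale: "transfer w (\<lambda>x. k * f x) x = k * transfer w f x"
  by (simp add: transfer_def algebra_simps)

lemma transfer_funpow_scale: "(transfer w ^^ n) (\<lambda>x. k * f x) x = k * (transfer w ^^ n) f x"
proof (induction n arbitrary: x)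
  case (Suc n)
  have "(transfer w ^^ n) (\<lambda>x. k * f x) = (\<lambda>x. k * (transfer w ^^ n) f x)"
    using Suc.IH by auto
  thus ?case by (simp add: transfer_scale)
qed simp

lemma transfer_funpow_supersolution:
  assumes "step_closed w D" "c \<ge> 0" "\<And>x. x \<in> D \<Longrightarrow> transfer w h x \<le> c * h x" "x \<in> D"
  shows "(transfer w ^^ n) h x \<le> c ^ n * h x"
  using assms(4)
proof (induction n arbitrary: x)
  case (Suc n)
  have "(transfer w ^^ Suc n) h x \<le> transfer w (\<lambda>x. c ^ n * h x) x"
    using transfer_mono[OF assms(1) Suc.IH Suc.prems] by simp
  also have "\<dots> \<le> c ^ n * (c * h x)"
    unfolding transfer_scale using assms(2,3) Suc.prems by (intro mult_left_mono) auto
  finally show ?case by (simp add: mult_ac)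
qed simp

lemma transfer_funpow_subsolution:
  assumes "step_closed w D" "c \<ge> 0" "\<And>x. x \<in> D \<Longrightarrow> c * h x \<le> transfer w h x" "x \<in> D"
  shows "c ^ n * h x \<le> (transfer w ^^ n) h x"
  using assms(4)
proof (induction n arbitrary: x)
  case (Suc n)
  have "c ^ n * (c * h x) \<le> transfer w (\<lambda>x. c ^ n * h x) x"
    unfolding transfer_scale using assms(2,3) Suc.prems by (intro mult_left_mono) auto
  also have "\<dots> \<le> (transfer w ^^ Suc n) h x"
    using transfer_mono[OF assms(1) Suc.IH Suc.prems] by simp
  finally show ?case by (simp add: mult_ac)
qed simp

lemma step_closed_pin_weight: "step_closed (pin_weight \<delta> T) UNIV"
  by (simp add: step_closed_def pin_weight_def)

lemma Zpart_le_supersolution: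
  assumes "c \<ge> 0" "\<And>x. transfer (pin_weight \<delta> T) h x \<le> c * h x" "b > 0" "\<And>x. b \<le> h x"
  shows "Zpart T N \<delta> \<le> h 0 / b * c ^ N"
proof -
  let ?K = "transfer (pin_weight \<delta> T) ^^ N"
  have "b * Zpart T N \<delta> = ?K (\<lambda>x. b * 1) 0"
    unfolding Zpart_eq_transfer transfer_funpow_scale ..
  also have "\<dots> \<le> ?K h 0"
    using assms(4) by (intro transfer_funpow_mono[OF step_closed_pin_weight]) auto
  also have "\<dots> \<le> c ^ N * h 0"
    using assms(1,2) by (intro transfer_funpow_supersolution[OF step_closed_pin_weight]) auto
  finally show ?thesis using assms(3) by (simp add: field_simps)
qed

lemma Zpart_ge_subsolution:
  assumes "c \<ge> 0" "\<And>x. c * h x \<le> transfer (pin_weight \<delta> T) h x" "b > 0" "\<And>x. h x \<le> b"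
  shows "h 0 / b * c ^ N \<le> Zpart T N \<delta>"
proof -
  let ?K = "transfer (pin_weight \<delta> T) ^^ N"
  have "c ^ N * h 0 \<le> ?K h 0"
    using assms(1,2) by (intro transfer_funpow_subsolution[OF step_closed_pin_weight]) auto
  also have "\<dots> \<le> ?K (\<lambda>x. b * 1) 0"
    using assms(4) by (intro transfer_funpow_mono[OF step_closed_pin_weight]) auto
  also have "\<dots> = b * Zpart T N \<delta>"
    unfolding Zpart_eq_transfer transfer_funpow_scale ..
  finally show ?thesis using assms(3) by (simp add: field_simps)
qed

text \<open>At multiples of \<open>T\<close> the function carries the factor \<open>exp (-\<delta>)\<close>, which cancels the pinning
  weight, so that the operator only sees the values of \<open>k\<close>.\<close>

definition periodize :: "real \<Rightarrow> nat \<Rightarrow> (int \<Rightarrow> real) \<Rightarrow> int \<Rightarrow> real" where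
  "periodize \<delta> T k x = (if int T dvd x then exp (- \<delta>) * k 0 else k (x mod int T))"

lemma transfer_periodize:
  assumes "T \<ge> 2" "k (int T) = k 0"
  shows "transfer (pin_weight \<delta> T) (periodize \<delta> T k) x =
    (if int T dvd x then (k 1 + k (int T - 1)) / 2
     else (k (x mod int T + 1) + k (x mod int T - 1)) / 2)"
proof -
  have *: "pin_weight \<delta> T y * periodize \<delta> T k y = k (y mod int T)" for y
    by (auto simp: pin_weight_def periodize_def exp_minus)
  define j where "j = x mod int T"
  have j: "0 \<le> j" "j < int T" using assms(1) by (auto simp: j_def)
  have p: "(x + 1) mod int T = (j + 1) mod int T" and m: "(x - 1) mod int T = (j - 1) mod int T"
    by (simp_all add: j_def mod_simps)
  have kp: "k ((x + 1) mod int T) = k (j + 1)"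
  proof (cases "j + 1 = int T")
    case True thus ?thesis using assms p by simp
  next
    case False thus ?thesis using j p by simp
  qed
  have km: "k ((x - 1) mod int T) = (if j = 0 then k (int T - 1) else k (j - 1))"
  proof (cases "j = 0")
    case True
    have "(-1) mod int T = int T - 1" using assms(1) by (simp add: zmod_minus1)
    thus ?thesis using True m by simp
  next
    case False thus ?thesis using j m by simp
  qed
  have "int T dvd x \<longleftrightarrow> j = 0" by (auto simp: j_def dvd_eq_mod_eq_0)
  thus ?thesis unfolding transfer_def * kp km by (auto simp: j_def)
qed

lemma mod_interior:
  assumes "T \<ge> 2" "\<not> int T dvd x"
  shows "0 < x mod int T" "x mod int T < int T"
proof -
  have "x mod int T \<noteq> 0" using assms(2) by (simp add: dvd_eq_mod_eq_0)
  moreover have "x mod int T \<ge> 0" using assms(1) by simp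
  ultimately show "0 < x mod int T" by linarith
  show "x mod int T < int T" using assms(1) by simp
qed

lemma Zpart_ge_periodic:
  assumes "T \<ge> 2" "c \<ge> 0" "k (int T) = k 0"
    and "c * (exp (- \<delta>) * k 0) \<le> (k 1 + k (int T - 1)) / 2"
    and "\<And>j. 0 < j \<Longrightarrow> j < int T \<Longrightarrow> c * k j \<le> (k (j + 1) + k (j - 1)) / 2"
    and "b > 0" "exp (- \<delta>) * k 0 \<le> b" "\<And>j. 0 < j \<Longrightarrow> j < int T \<Longrightarrow> k j \<le> b"
  shows "exp (- \<delta>) * k 0 / b * c ^ N \<le> Zpart T N \<delta>"
proof -
  have "periodize \<delta> T k 0 / b * c ^ N \<le> Zpart T N \<delta>"
  proof (rule Zpart_ge_subsolution[OF assms(2) _ assms(6)])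
    show "c * periodize \<delta> T k x \<le> transfer (pin_weight \<delta> T) (periodize \<delta> T k) x" for x
      unfolding transfer_periodize[OF assms(1,3)]
      using assms(4) assms(5)[OF mod_interior[OF assms(1)]] by (auto simp: periodize_def)
    show "periodize \<delta> T k x \<le> b" for x
      using assms(7) assms(8)[OF mod_interior[OF assms(1)]] by (auto simp: periodize_def)
  qed
  thus ?thesis by (simp add: periodize_def)
qed

lemma Zpart_le_periodic:
  assumes "T \<ge> 2" "c \<ge> 0" "k (int T) = k 0"
    and "(k 1 + k (int T - 1)) / 2 \<le> c * (exp (- \<delta>) * k 0)"
    and "\<And>j. 0 < j \<Longrightarrow> j < int T \<Longrightarrow> (k (j + 1) + k (j - 1)) / 2 \<le> c * k j"
    and "b > 0" "b \<le> exp (- \<delta>) * k 0" "\<And>j. 0 < j \<Longrightarrow> j < int T \<Longrightarrow> b \<le> k j"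
  shows "Zpart T N \<delta> \<le> exp (- \<delta>) * k 0 / b * c ^ N"
proof -
  have "Zpart T N \<delta> \<le> periodize \<delta> T k 0 / b * c ^ N"
  proof (rule Zpart_le_supersolution[OF assms(2) _ assms(6)])
    show "transfer (pin_weight \<delta> T) (periodize \<delta> T k) x \<le> c * periodize \<delta> T k x" for x
      unfolding transfer_periodize[OF assms(1,3)]
      using assms(4) assms(5)[OF mod_interior[OF assms(1)]] by (auto simp: periodize_def)
    show "b \<le> periodize \<delta> T k x" for x
      using assms(7) assms(8)[OF mod_interior[OF assms(1)]] by (auto simp: periodize_def)
  qed
  thus ?thesis by (simp add: periodize_def)
qed

section \<open>Laplace transforms of hitting times\<close>

lemma transfer_funpow_add:
  "(transfer w ^^ n) (\<lambda>x. f x + g x) x = (transfer w ^^ n) f x + (transfer w ^^ n) g x"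
proof (induction n arbitrary: x)
  case (Suc n)
  have "(transfer w ^^ n) (\<lambda>x. f x + g x)
      = (\<lambda>x. (transfer w ^^ n) f x + (transfer w ^^ n) g x)"
    using Suc.IH by auto
  thus ?case by (simp add: transfer_def[of w "\<lambda>x. _ x + _ x"]
      transfer_def[of w "(transfer w ^^ n) f"] transfer_def[of w "(transfer w ^^ n) g"]
      field_simps)
qed simp

lemma transfer_funpow_cong:
  assumes "step_closed w D" "\<And>x. x \<in> D \<Longrightarrow> f x = g x" "x \<in> D"
  shows "(transfer w ^^ n) f x = (transfer w ^^ n) g x"
  using transfer_funpow_mono[of w D f g x n] transfer_funpow_mono[of w D g f x n] assms
  by (intro antisym) auto

text \<open>The hypothesis on \<open>G\<close> is the one-step decomposition of
  \<open>G x = E\<^sub>x[c\<^bsup>-\<tau>\<^esup>]\<close>, \<open>\<tau>\<close> being the hitting time of \<open>A\<close>.\<close>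

lemma hit_prob_telescope:
  assumes "step_closed (avoid A) D" "0 \<in> D"
    and G: "\<And>x. x \<in> D \<Longrightarrow>
      c * G x = transfer (\<lambda>_. 1) (indicator A) x + transfer (avoid A) G x"
  shows "hit_prob A (Suc n)
    = c * (transfer (avoid A) ^^ n) G 0 - (transfer (avoid A) ^^ Suc n) G 0"
proof -
  let ?K = "transfer (avoid A)"
  have "c * (?K ^^ n) G 0 = (?K ^^ n) (\<lambda>x. c * G x) 0"
    by (simp add: transfer_funpow_scale)
  also have "\<dots> = (?K ^^ n) (\<lambda>x. transfer (\<lambda>_. 1) (indicator A) x + ?K G x) 0"
    by (rule transfer_funpow_cong[OF assms(1) G assms(2)])
  also have "\<dots> = hit_prob A (Suc n) + (?K ^^ n) (?K G) 0"
    by (simp only: transfer_funpow_add hit_prob_Suc)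
  finally show ?thesis by (simp add: funpow_swap1)
qed

lemma exp_minus_ln_mult: "c > 0 \<Longrightarrow> exp (- ln c * real n) = 1 / c ^ n"
  by (simp add: exp_minus exp_of_nat_mult field_simps mult.commute[of "ln c"])

lemma Qhit_ln_eq:
  assumes "step_closed (avoid A) D" "0 \<in> D" "c > 0"
    and G: "\<And>x. x \<in> D \<Longrightarrow>
      c * G x = transfer (\<lambda>_. 1) (indicator A) x + transfer (avoid A) G x"
    and lim: "(\<lambda>n. (transfer (avoid A) ^^ n) G 0 / c ^ n) \<longlonglongrightarrow> 0"
  shows "Qhit A (ln c) = ennreal (G 0)"
proof -
  let ?r = "\<lambda>n. (transfer (avoid A) ^^ n) G 0 / c ^ n"
  let ?f = "\<lambda>n. hit_prob A n * exp (- ln c * real n)"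
  have "?f (Suc n) = ?r n - ?r (Suc n)" for n
    using \<open>c > 0\<close> hit_prob_telescope[OF assms(1,2) G, of n]
    unfolding exp_minus_ln_mult[OF \<open>c > 0\<close>] by (simp add: field_simps)
  moreover have "(\<lambda>n. ?r n - ?r (Suc n)) sums (?r 0 - 0)"
    using lim by (rule telescope_sums')
  ultimately have "(\<lambda>n. ?f (Suc n)) sums G 0" by simp
  hence "?f sums G 0" by (subst (asm) sums_Suc_iff) simp
  thus ?thesis unfolding Qhit_def
    by (intro suminf_ennreal_eq) (auto simp: hit_prob_nonneg)
qed

lemma Qhit_sums:
  assumes "Qhit A l = ennreal y" "y > 0"
  shows "(\<lambda>n. hit_prob A n * exp (- l * real n)) sums y"
proof -
  let ?f = "\<lambda>n. hit_prob A n * exp (- l * real n)"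
  have nn: "?f n \<ge> 0" for n by (simp add: hit_prob_nonneg)
  have "(\<Sum>n. ennreal (?f n)) \<noteq> top" using assms by (simp add: Qhit_def)
  hence summ: "summable ?f" by (intro summable_suminf_not_top nn)
  have "ennreal (suminf ?f) = ennreal y"
    using suminf_ennreal2[OF nn summ] assms(1) by (simp only: Qhit_def)
  moreover have "suminf ?f \<ge> 0" by (rule suminf_nonneg[OF summ nn])
  ultimately have "suminf ?f = y" using \<open>y > 0\<close> by simp
  thus ?thesis using summ by (simp only: sums_iff)
qed

lemma Qhit_inj:
  assumes "Qhit A l = ennreal y" "Qhit A l' = ennreal y" "y > 0"
  shows "l = l'"
proof -
  have False if l: "l < l'" and Q: "Qhit A l = ennreal y" "Qhit A l' = ennreal y" for l l'
  proof -
    let ?f = "\<lambda>l n. hit_prob A n * exp (- l * real n)"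
    have s: "?f l sums y" "?f l' sums y" using Q \<open>y > 0\<close> by (blast intro: Qhit_sums)+
    have d: "(\<lambda>n. ?f l n - ?f l' n) sums 0" using sums_diff[OF s] by simp
    have "?f l n - ?f l' n \<ge> 0" for n
      using l by (simp add: hit_prob_nonneg mult_left_mono mult_right_mono)
    hence eq: "?f l n - ?f l' n = 0" for n
      using d suminf_eq_zero_iff[of "\<lambda>n. ?f l n - ?f l' n"] by (auto simp: sums_iff)
    have "hit_prob A n = 0" for n
    proof (cases "n = 0")
      case False
      hence "exp (- l * real n) \<noteq> exp (- l' * real n)" using l by simp
      thus ?thesis using eq[of n] by auto
    qed simp
    hence "?f l = (\<lambda>_. 0)" by simp
    thus False using s(1) \<open>y > 0\<close> by (simp add: sums_iff)
  qed
  thus ?thesis using assms by (meson linorder_neqE_linordered_idom)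
qed

section \<open>First return to the origin\<close>

definition return_fun :: "real \<Rightarrow> int \<Rightarrow> real" where
  "return_fun a x = (if x = 0 then exp (- a) / cosh a else exp (- a * \<bar>real_of_int x\<bar>))"

lemma two_cosh_mult_exp: "2 * cosh a * exp b = exp (b + a) + exp (b - a :: real)"
  by (simp add: cosh_field_def exp_add exp_diff exp_minus field_simps)

lemma return_fun_one_step:
  "cosh a * return_fun a x
    = transfer (\<lambda>_. 1) (indicator {0}) x + transfer (avoid {0}) (return_fun a) x"
proof -
  define e where "e y = exp (- a * \<bar>real_of_int y\<bar>)" for y
  have "indicator {0} y + avoid {0} y * return_fun a y = e y" for y
    by (simp add: avoid_def return_fun_def e_def)
  from this[of "x + 1"] this[of "x - 1"]
  have "transfer (\<lambda>_. 1) (indicator {0}) x + transfer (avoid {0}) (return_fun a) x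
      = (e (x + 1) + e (x - 1)) / 2"
    unfolding transfer_def by argo
  also have "\<dots> = cosh a * return_fun a x"
  proof (cases "x = 0")
    case True
    thus ?thesis by (simp add: return_fun_def e_def cosh_real_pos less_imp_neq[symmetric])
  next
    case False
    then consider "x \<ge> 1" | "x \<le> -1" by linarith
    thus ?thesis
    proof cases
      case 1
      hence "e (x + 1) = exp (- a * x - a)" "e (x - 1) = exp (- a * x + a)"
        by (auto simp: e_def algebra_simps)
      thus ?thesis using 1 two_cosh_mult_exp[of a "- a * x"] by (simp add: return_fun_def)
    next
      case 2
      hence "e (x + 1) = exp (a * x + a)" "e (x - 1) = exp (a * x - a)"
        by (auto simp: e_def algebra_simps)
      thus ?thesis using 2 two_cosh_mult_exp[of a "a * x"] by (simp add: return_fun_def)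
    qed
  qed
  finally show ?thesis ..
qed

lemma step_closed_avoid_UNIV: "step_closed (avoid A) UNIV"
  by (simp add: step_closed_def avoid_def)

lemma transfer_avoid_funpow_bounds:
  assumes "\<And>x. 0 \<le> f x" "\<And>x. f x \<le> 1"
  shows "0 \<le> (transfer (avoid A) ^^ n) f 0" "(transfer (avoid A) ^^ n) f 0 \<le> 1"
proof -
  have "1 ^ n * 0 \<le> (transfer (avoid A) ^^ n) (\<lambda>_. 0) 0"
    by (rule transfer_funpow_subsolution[OF step_closed_avoid_UNIV]) (auto simp: transfer_def)
  also have "\<dots> \<le> (transfer (avoid A) ^^ n) f 0"
    by (rule transfer_funpow_mono[OF step_closed_avoid_UNIV]) (use assms in auto)
  finally show "0 \<le> (transfer (avoid A) ^^ n) f 0" by simp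
  have "(transfer (avoid A) ^^ n) f 0 \<le> (transfer (avoid A) ^^ n) (\<lambda>_. 1) 0"
    by (rule transfer_funpow_mono[OF step_closed_avoid_UNIV]) (use assms in auto)
  also have "\<dots> \<le> 1 ^ n * 1"
    by (rule transfer_funpow_supersolution[OF step_closed_avoid_UNIV])
      (auto simp: transfer_def avoid_def)
  finally show "(transfer (avoid A) ^^ n) f 0 \<le> 1" by simp
qed

lemma return_fun_bounds:
  assumes "a \<ge> 0"
  shows "0 \<le> return_fun a x" "return_fun a x \<le> 1"
proof -
  have "exp (- a) \<le> 1" "cosh a \<ge> 1" using assms cosh_real_ge_1 by auto
  hence "exp (- a) \<le> cosh a" "cosh a \<ge> 1" by linarith+
  thus "0 \<le> return_fun a x" "return_fun a x \<le> 1"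
    using assms by (auto simp: return_fun_def divide_le_eq)
qed

lemma Q_inf_ln_cosh_pos:
  assumes "a > 0"
  shows "Q_inf (ln (cosh a)) = ennreal (exp (- a) / cosh a)"
proof -
  let ?c = "cosh a"
  have c: "?c > 1" using assms cosh_real_strict_mono[of 0 a] by simp
  have "Qhit {0} (ln ?c) = ennreal (return_fun a 0)"
  proof (rule Qhit_ln_eq[OF step_closed_avoid_UNIV])
    have geo: "(\<lambda>n. 1 / ?c ^ n) \<longlonglongrightarrow> 0"
      using LIMSEQ_realpow_zero[of "1 / ?c"] c by (simp add: power_divide)
    have bounds: "0 \<le> (transfer (avoid {0}) ^^ n) (return_fun a) 0 / ?c ^ n"
      "(transfer (avoid {0}) ^^ n) (return_fun a) 0 / ?c ^ n \<le> 1 / ?c ^ n" for n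
      using c assms transfer_avoid_funpow_bounds[where f = "return_fun a" and A = "{0}" and n = n]
        return_fun_bounds[of a]
      by (auto intro!: divide_right_mono)
    show "(\<lambda>n. (transfer (avoid {0}) ^^ n) (return_fun a) 0 / ?c ^ n) \<longlonglongrightarrow> 0"
      by (rule real_tendsto_sandwich[OF _ _ tendsto_const geo]) (use bounds in auto)
  next
    show "cosh a * return_fun a x
      = transfer (\<lambda>_. 1) (indicator {0}) x + transfer (avoid {0}) (return_fun a) x" for x
      by (rule return_fun_one_step)
  qed (use c in auto)
  thus ?thesis by (simp add: Q_inf_def return_fun_def)
qed

lemma Q_inf_0: "Q_inf 0 = 1"
proof (rule antisym)
  have one: "return_fun 0 = (\<lambda>_. 1)" by (auto simp: return_fun_def)
  have hit: "hit_prob {0} (Suc n)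
      = (transfer (avoid {0}) ^^ n) (\<lambda>_. 1) 0 - (transfer (avoid {0}) ^^ Suc n) (\<lambda>_. 1) 0" for n
    using hit_prob_telescope[OF step_closed_avoid_UNIV, where A = "{0}" and c = 1
        and G = "return_fun 0" and n = n]
      return_fun_one_step[of 0] by (simp add: one)
  have "(\<Sum>k<n. hit_prob {0} k) \<le> 1" for n
  proof (cases n)
    case (Suc m)
    have "(\<Sum>k<m. hit_prob {0} (Suc k)) = 1 - (transfer (avoid {0}) ^^ m) (\<lambda>_. 1) 0"
      unfolding hit by (induction m) auto
    moreover have "\<dots> \<le> 1" 
      using transfer_avoid_funpow_bounds(1)[where f = "\<lambda>_. 1" and A = "{0}" and n = m] by simp
    ultimately show ?thesis unfolding Suc sum.lessThan_Suc_shift by simp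
  qed simp
  hence "(\<Sum>k<n. ennreal (hit_prob {0} k)) \<le> 1" for n
    by (simp add: sum_ennreal hit_prob_nonneg)
  thus "Q_inf 0 \<le> 1" unfolding Q_inf_def Qhit_def
    by (intro suminf_le_const) (auto intro: summableI)
next
  have le: "ennreal (exp (- a) / cosh a) \<le> Q_inf 0" if "a > 0" for a
  proof -
    have "ln (cosh a) \<ge> 0" using cosh_real_ge_1[of a] by simp
    hence "Q_inf (ln (cosh a)) \<le> Q_inf 0" unfolding Q_inf_def Qhit_def
      by (intro suminf_le ennreal_leI) (auto intro!: summableI mult_left_le simp: hit_prob_nonneg)
    thus ?thesis using Q_inf_ln_cosh_pos[OF that] by simp
  qed
  have "isCont (\<lambda>a::real. exp (- a) / cosh a) 0" by (intro continuous_intros) auto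
  hence "((\<lambda>a::real. exp (- a) / cosh a) \<longlongrightarrow> 1) (at_right 0)"
    by (simp add: isCont_def filterlim_at_split)
  hence "((\<lambda>a::real. ennreal (exp (- a) / cosh a)) \<longlongrightarrow> ennreal 1) (at_right 0)"
    by (rule tendsto_ennrealI)
  moreover have "eventually (\<lambda>a. ennreal (exp (- a) / cosh a) \<le> Q_inf 0) (at_right 0)"
    using le by (auto simp: eventually_at_filter)
  ultimately show "1 \<le> Q_inf 0"
    by (intro tendsto_upperbound[where F = "at_right (0::real)"
          and f = "\<lambda>a. ennreal (exp (- a) / cosh a)"]) auto
qed

lemma Q_inf_ln_cosh:
  assumes "a \<ge> 0"
  shows "Q_inf (ln (cosh a)) = ennreal (exp (- a) / cosh a)"
  using assms Q_inf_0 Q_inf_ln_cosh_pos[of a] by (cases "a = 0") auto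

lemma phi_inf_eqI:
  assumes "Q_inf l = ennreal (min (exp (- d)) 1)"
  shows "phi_inf d = l"
  unfolding phi_inf_def Q_inf_inv_def
proof (rule the_equality)
  show "Q_inf l = ennreal (min (exp (- d)) 1)" by (rule assms)
  show "l' = l" if "Q_inf l' = ennreal (min (exp (- d)) 1)" for l'
    using Qhit_inj[of "{0}" l' "min (exp (- d)) 1" l] that assms by (simp add: Q_inf_def)
qed

text \<open>The solution \<open>a\<close> of \<open>exp (-a) / cosh a = exp (-d)\<close>.\<close>
definition decay :: "real \<Rightarrow> real" where
  "decay d = ln (2 * exp d - 1) / 2"

lemma exp_decay_sq:
  assumes "d \<ge> 0"
  shows "exp (decay d) ^ 2 = 2 * exp d - 1"
proof -
  have "2 * exp d - 1 > 0" using assms one_le_exp_iff[of d] by linarith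
  thus ?thesis by (simp add: decay_def exp_double[symmetric])
qed

lemma cosh_decay:
  assumes "d \<ge> 0"
  shows "decay d \<ge> 0" "exp (- decay d) = cosh (decay d) * exp (- d)"
proof -
  have "2 * exp d - 1 \<ge> 1" using assms one_le_exp_iff[of d] by linarith
  thus "decay d \<ge> 0" by (simp add: decay_def)
  have "exp (decay d) * exp (decay d) = 2 * exp d - 1"
    using exp_decay_sq[OF assms] by (simp add: power2_eq_square)
  thus "exp (- decay d) = cosh (decay d) * exp (- d)"
    by (simp add: cosh_field_def exp_minus field_simps)
qed

lemma ln_cosh_decay:
  assumes "d \<ge> 0"
  shows "ln (cosh (decay d)) = d / 2 - ln (sqrt (2 - exp (- d)))"
proof -
  have p: "2 - exp (- d) > 0" using assms by (smt (verit) one_le_exp_iff exp_le_one_iff)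
  have e: "2 * exp d - 1 = exp d * (2 - exp (- d))" by (simp add: exp_minus field_simps)
  have "decay d = d / 2 + ln (2 - exp (- d)) / 2"
    unfolding decay_def e using p by (simp add: ln_mult)
  moreover have "cosh (decay d) = exp (d - decay d)"
    using cosh_decay(2)[OF assms] by (simp add: exp_diff exp_minus field_simps)
  ultimately show ?thesis using p by (simp add: ln_sqrt)
qed

lemma phi_inf_eq: "phi_inf d = (if d \<ge> 0 then d / 2 - ln (sqrt (2 - exp (- d))) else 0)"
proof (cases "d \<ge> 0")
  case True
  have "cosh (decay d) \<noteq> 0" by (simp add: less_imp_neq[symmetric])
  hence "Q_inf (ln (cosh (decay d))) = ennreal (min (exp (- d)) 1)"
    using Q_inf_ln_cosh cosh_decay[OF True] True by simp
  thus ?thesis using phi_inf_eqI[of "ln (cosh (decay d))" d] ln_cosh_decay[OF True] True by simp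
next
  case False
  have "phi_inf d = 0" using False by (intro phi_inf_eqI) (simp add: Q_inf_0)
  thus ?thesis using False by simp
qed

section \<open>Chebyshev polynomials\<close>

fun cheb :: "nat \<Rightarrow> 'a::comm_ring_1 \<Rightarrow> 'a" where
  "cheb 0 c = 1"
| "cheb (Suc 0) c = c"
| "cheb (Suc (Suc n)) c = 2 * c * cheb (Suc n) c - cheb n c"

fun cheb_deriv :: "nat \<Rightarrow> 'a::comm_ring_1 \<Rightarrow> 'a" where
  "cheb_deriv 0 c = 0"
| "cheb_deriv (Suc 0) c = 1"
| "cheb_deriv (Suc (Suc n)) c = 2 * cheb (Suc n) c + 2 * c * cheb_deriv (Suc n) c - cheb_deriv n c"

lemma has_field_derivative_cheb:
  fixes c :: "'a::real_normed_field"
  shows "(cheb n has_field_derivative cheb_deriv n c) (at c)"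
proof (induction n c rule: cheb.induct)
  case (3 n c)
  have "((\<lambda>c. 2 * c * cheb (Suc n) c - cheb n c) has_field_derivative
      (2 * cheb (Suc n) c + 2 * c * cheb_deriv (Suc n) c) - cheb_deriv n c) (at c)"
    by (rule derivative_eq_intros 3 refl | simp add: algebra_simps)+
  thus ?case by (simp add: fun_eq_iff)
qed simp_all

lemma cheb_of_real: "cheb n (of_real c :: 'a::{real_algebra_1,comm_ring_1}) = of_real (cheb n c)"
  by (induction n c rule: cheb.induct) auto

lemma cheb_deriv_of_real:
  "cheb_deriv n (of_real c :: 'a::{real_algebra_1,comm_ring_1}) = of_real (cheb_deriv n c)"
  by (induction n c rule: cheb.induct) (auto simp: cheb_of_real)

lemma cheb_wronskian_pos:
  fixes c :: real
  shows "cheb_deriv (Suc n) c * cheb n c - cheb (Suc n) c * cheb_deriv n c > 0"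
proof (induction n)
  case (Suc n)
  have "cheb_deriv (Suc (Suc n)) c * cheb (Suc n) c - cheb (Suc (Suc n)) c * cheb_deriv (Suc n) c
      = 2 * (cheb (Suc n) c)\<^sup>2 + (cheb_deriv (Suc n) c * cheb n c - cheb (Suc n) c * cheb_deriv n c)"
    by (simp add: algebra_simps power2_eq_square)
  thus ?case using Suc zero_le_power2[of "cheb (Suc n) c"] by linarith
qed simp

definition cheb_int :: "int \<Rightarrow> real \<Rightarrow> real" where
  "cheb_int j c = cheb (nat \<bar>j\<bar>) c"

lemma cheb_int_uminus: "cheb_int (- j) c = cheb_int j c"
  by (simp add: cheb_int_def)

lemma cheb_int_rec: "cheb_int (j + 1) c + cheb_int (j - 1) c = 2 * c * cheb_int j c"
proof -
  have pos: "cheb_int (j + 1) c + cheb_int (j - 1) c = 2 * c * cheb_int j c" if "j \<ge> 1" for j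
  proof -
    define n where "n = nat (j - 1)"
    have "nat \<bar>j + 1\<bar> = Suc (Suc n)" "nat \<bar>j\<bar> = Suc n" "nat \<bar>j - 1\<bar> = n"
      using that unfolding n_def by linarith+
    thus ?thesis by (simp add: cheb_int_def)
  qed
  consider "j \<ge> 1" | "j = 0" | "- j \<ge> 1" by linarith
  thus ?thesis
  proof cases
    case 1
    thus ?thesis by (rule pos)
  next
    case 2
    thus ?thesis by (simp add: cheb_int_def)
  next
    case 3
    have "cheb_int (j + 1) c = cheb_int (- j - 1) c" "cheb_int (j - 1) c = cheb_int (- j + 1) c"
      using cheb_int_uminus[of "j + 1" c] cheb_int_uminus[of "j - 1" c] by simp_all
    thus ?thesis using pos[OF 3] cheb_int_uminus[of j c] by simp
  qed
qed

definition cheb_positive :: "nat \<Rightarrow> real \<Rightarrow> bool" where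
  "cheb_positive p c \<longleftrightarrow> 0 < c \<and> (\<forall>n\<le>Suc p. 0 < cheb n c)"

definition spectral :: "nat \<Rightarrow> 'a::field \<Rightarrow> 'a" where
  "spectral p c = c * cheb (Suc p) c / cheb p c"

lemma cheb_positiveD:
  assumes "cheb_positive p c"
  shows "c > 0" "n \<le> Suc p \<Longrightarrow> cheb n c > 0" "spectral p c > 0"
  using assms by (auto simp: cheb_positive_def spectral_def)

lemma cheb_positive_Suc: "cheb_positive (Suc p) c \<longleftrightarrow> cheb_positive p c \<and> 0 < cheb (Suc (Suc p)) c"
  by (auto simp: cheb_positive_def le_Suc_eq simp del: cheb.simps)

lemma cheb_ratio_mono:
  assumes "cheb_positive p c" "c \<le> c'"
  shows "cheb_positive p c' \<and> cheb (Suc p) c / cheb p c \<le> cheb (Suc p) c' / cheb p c'"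
  using assms
proof (induction p)
  case 0
  thus ?case by (auto simp: cheb_positive_def le_Suc_eq)
next
  case (Suc p)
  have dom: "cheb_positive p c" "cheb (Suc (Suc p)) c > 0" using Suc.prems(1) cheb_positive_Suc by auto
  have IH: "cheb_positive p c'" "cheb (Suc p) c / cheb p c \<le> cheb (Suc p) c' / cheb p c'"
    using Suc.IH dom(1) Suc.prems(2) by auto
  have pos: "cheb (Suc p) c > 0" "cheb p c > 0" "cheb (Suc p) c' > 0" "cheb p c' > 0"
    using cheb_positiveD(2)[OF dom(1)] cheb_positiveD(2)[OF IH(1)] by auto
  have ratio: "cheb (Suc (Suc p)) b / cheb (Suc p) b = 2 * b - cheb p b / cheb (Suc p) b"
    if "cheb (Suc p) b > 0" for b :: real using that by (simp add: field_simps)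
  have "cheb p c' / cheb (Suc p) c' \<le> cheb p c / cheb (Suc p) c"
    using IH(2) pos by (simp add: field_simps)
  hence le: "cheb (Suc (Suc p)) c / cheb (Suc p) c \<le> cheb (Suc (Suc p)) c' / cheb (Suc p) c'"
    unfolding ratio[OF pos(1)] ratio[OF pos(3)] using Suc.prems(2) by linarith
  have "0 < cheb (Suc (Suc p)) c / cheb (Suc p) c" using dom(2) pos(1) by (rule divide_pos_pos)
  hence "0 < cheb (Suc (Suc p)) c' / cheb (Suc p) c'" using le by linarith
  hence "cheb (Suc (Suc p)) c' > 0" using pos(3) by (simp only: zero_less_divide_iff) linarith
  thus ?case using le IH(1) cheb_positive_Suc by blast
qed

lemma spectral_strict_mono:
  assumes "cheb_positive p c" "c < c'"
  shows "spectral p c < spectral p c'"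
proof -
  have r: "cheb_positive p c'" "cheb (Suc p) c / cheb p c \<le> cheb (Suc p) c' / cheb p c'"
    using cheb_ratio_mono[OF assms(1), of c'] assms(2) by auto
  have "cheb (Suc p) c / cheb p c > 0"
    using cheb_positiveD(2)[OF assms(1)] by simp
  hence "c * (cheb (Suc p) c / cheb p c) < c' * (cheb (Suc p) c' / cheb p c')"
    using r(2) assms(2) cheb_positiveD(1)[OF assms(1)] by (intro mult_less_le_imp_less) auto
  thus ?thesis by (simp add: spectral_def)
qed

lemma cheb_ge_1:
  fixes c :: real
  assumes "c \<ge> 1"
  shows "cheb n c \<ge> 1 \<and> cheb n c \<le> cheb (Suc n) c"
proof (induction n)
  case (Suc n)
  have "2 * cheb (Suc n) c \<le> 2 * c * cheb (Suc n) c"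
    using assms Suc by (intro mult_right_mono) auto
  hence "cheb (Suc n) c \<le> cheb (Suc (Suc n)) c" using Suc by (simp only: cheb.simps) linarith
  thus ?case using Suc by linarith
qed (use assms in simp)

text \<open>Where \<open>spectral p\<close> takes the value 1/2, \<open>cheb (Suc (Suc p))\<close> vanishes; this point is therefore
  the left end of the domain for \<open>Suc p\<close>.\<close>

lemma spectral_surj:
  assumes "y > 0"
  shows "\<exists>c. cheb_positive p c \<and> spectral p c = y"
  using assms
proof (induction p arbitrary: y)
  case 0
  thus ?case
    by (intro exI[of _ "sqrt y"]) (auto simp: cheb_positive_def le_Suc_eq spectral_def)
next
  case (Suc p)
  obtain c1 where c1: "cheb_positive p c1" "spectral p c1 = 1 / 2" using Suc.IH[of "1 / 2"] by auto
  have dom: "cheb_positive p c" if "c \<ge> c1" for c using cheb_ratio_mono[OF c1(1) that] by simp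
  define M where "M = max c1 (max 1 y)"
  have "spectral (Suc p) c1 = 0"
    using c1 cheb_positiveD(2)[OF c1(1), of p] by (simp add: spectral_def field_simps)
  moreover have "y \<le> spectral (Suc p) M"
  proof -
    have "M \<ge> 1" "y \<le> M" by (auto simp: M_def)
    have "M * cheb (Suc p) M \<le> M * cheb (Suc (Suc p)) M" "cheb (Suc p) M > 0"
      using cheb_ge_1[OF \<open>M \<ge> 1\<close>, of "Suc p"] \<open>M \<ge> 1\<close>
      by (auto intro!: mult_left_mono simp del: cheb.simps)
    hence "M \<le> spectral (Suc p) M" by (simp add: spectral_def pos_le_divide_eq del: cheb.simps)
    thus ?thesis using \<open>y \<le> M\<close> by simp
  qed
  moreover have "continuous_on {c1..M} (spectral (Suc p))"
  proof -
    have "continuous_on {c1..M} (cheb n)" for n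
      by (intro continuous_at_imp_continuous_on ballI DERIV_isCont[OF has_field_derivative_cheb])
    moreover have "cheb (Suc p) c \<noteq> 0" if "c \<in> {c1..M}" for c
      using cheb_positiveD(2)[OF dom, of c "Suc p"] that by simp
    ultimately show ?thesis unfolding spectral_def
      by (intro continuous_intros) (auto simp del: cheb.simps)
  qed
  moreover have "c1 \<le> M" by (simp add: M_def)
  ultimately obtain c where c: "c1 \<le> c" "spectral (Suc p) c = y"
    using IVT'[of "spectral (Suc p)" c1 y M] Suc.prems by auto
  have "cheb (Suc p) c > 0" "c > 0" using cheb_positiveD[OF dom[OF c(1)]] by auto
  hence "cheb (Suc (Suc p)) c > 0"
    using c(2) Suc.prems by (auto simp: spectral_def zero_less_divide_iff zero_less_mult_iff
        simp del: cheb.simps)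
  thus ?case using c(2) dom[OF c(1)] cheb_positive_Suc by blast
qed

section \<open>First hit of \<open>{-T, 0, T}\<close>\<close>

definition exit_fun :: "nat \<Rightarrow> real \<Rightarrow> int \<Rightarrow> real" where
  "exit_fun p c x = (if x = 0 then cheb p c / (c * cheb (Suc p) c)
     else cheb_int (int (Suc p) - \<bar>x\<bar>) c / cheb (Suc p) c)"

lemma exit_fun_one_step:
  fixes p :: nat
  defines "A \<equiv> {- int (2 * Suc p), 0, int (2 * Suc p)}"
  assumes "cheb_positive p c" "\<bar>x\<bar> < int (2 * Suc p)"
  shows "c * exit_fun p c x
    = transfer (\<lambda>_. 1) (indicator A) x + transfer (avoid A) (exit_fun p c) x"
proof -
  let ?m = "int (Suc p)"
  have pos: "c > 0" "cheb (Suc p) c > 0" using cheb_positiveD[OF assms(2)] by auto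
  define g where "g y = cheb_int (?m - \<bar>y\<bar>) c / cheb (Suc p) c" for y
  have gA: "g y = 1" if "y \<in> A" for y
  proof -
    have "nat \<bar>?m - \<bar>y\<bar>\<bar> = Suc p" using that by (auto simp: A_def)
    thus ?thesis using pos(2) by (simp only: g_def cheb_int_def) simp
  qed
  have "indicator A y + avoid A y * exit_fun p c y = g y" for y
    using gA[of y] by (cases "y \<in> A") (auto simp: avoid_def exit_fun_def g_def A_def)
  from this[of "x + 1"] this[of "x - 1"]
  have "transfer (\<lambda>_. 1) (indicator A) x + transfer (avoid A) (exit_fun p c) x
      = (g (x + 1) + g (x - 1)) / 2"
    unfolding transfer_def by argo
  also have "\<dots> = c * exit_fun p c x"
  proof (cases "x = 0")
    case True
    have "g 1 = cheb p c / cheb (Suc p) c" "g (- 1) = cheb p c / cheb (Suc p) c"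
      by (simp_all add: g_def cheb_int_def)
    thus ?thesis using True pos by (simp add: exit_fun_def)
  next
    case False
    define j where "j = ?m - \<bar>x\<bar>"
    have "g (x + 1) + g (x - 1) = (cheb_int (j + 1) c + cheb_int (j - 1) c) / cheb (Suc p) c"
    proof (cases "x > 0")
      case True
      hence "?m - \<bar>x + 1\<bar> = j - 1" "?m - \<bar>x - 1\<bar> = j + 1" by (auto simp: j_def)
      thus ?thesis by (simp only: g_def add_divide_distrib)
    next
      case False
      hence "?m - \<bar>x + 1\<bar> = j + 1" "?m - \<bar>x - 1\<bar> = j - 1" using \<open>x \<noteq> 0\<close> by (auto simp: j_def)
      thus ?thesis by (simp only: g_def add_divide_distrib)
    qed
    thus ?thesis using False unfolding cheb_int_rec by (simp add: exit_fun_def j_def)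
  qed
  finally show ?thesis ..
qed

lemma exit_fun_pos:
  assumes "cheb_positive p c" "\<bar>x\<bar> < int (2 * Suc p)"
  shows "exit_fun p c x > 0"
proof -
  have "nat \<bar>int (Suc p) - \<bar>x\<bar>\<bar> \<le> Suc p" using assms(2) by auto
  thus ?thesis using cheb_positiveD[OF assms(1)]
    by (auto simp: exit_fun_def cheb_int_def simp del: cheb.simps)
qed

lemma step_closed_avoid_interval:
  assumes "T > 0"
  shows "step_closed (avoid {- int T, 0, int T}) {x. \<bar>x\<bar> < int T}"
  using assms by (auto simp: step_closed_def avoid_def)

lemma Q_fin_ln_eq:
  assumes "cheb_positive p c"
  shows "Q_fin (2 * Suc p) (ln c) = ennreal (1 / spectral p c)"
proof -
  let ?T = "2 * Suc p"
  define A where "A = {- int ?T, 0, int ?T}"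
  define D where "D = {x. \<bar>x\<bar> < int ?T}"
  let ?K = "transfer (avoid A)"
  have closed: "step_closed (avoid A) D"
    unfolding A_def D_def by (rule step_closed_avoid_interval) simp
  have zero: "0 \<in> D" by (simp add: D_def)
  have one_step: "b * exit_fun p b x = transfer (\<lambda>_. 1) (indicator A) x + ?K (exit_fun p b) x"
    if "cheb_positive p b" "x \<in> D" for b x
    using exit_fun_one_step[of p b x] that by (simp only: A_def D_def mem_Collect_eq)
  have pos: "exit_fun p b x > 0" if "cheb_positive p b" "x \<in> D" for b x
    using exit_fun_pos that by (auto simp: D_def)
  have "c > 0" using cheb_positiveD(1)[OF assms] .
  obtain b where b: "cheb_positive p b" "spectral p b = spectral p c / 2"
    using spectral_surj[of "spectral p c / 2" p] cheb_positiveD(3)[OF assms] by auto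
  have "b < c"
  proof (rule ccontr)
    assume "\<not> b < c"
    hence "spectral p c \<le> spectral p b"
      using spectral_strict_mono[OF assms, of b] by (cases "b = c") auto
    thus False using b(2) cheb_positiveD(3)[OF assms] by simp
  qed
  have "b > 0" using cheb_positiveD(1)[OF b(1)] .
  have "finite D"
    by (rule finite_subset[of _ "{- int ?T..int ?T}"]) (auto simp: D_def)
  define M where "M = (\<Sum>x\<in>D. exit_fun p c x / exit_fun p b x)"
  have M: "exit_fun p c x \<le> M * exit_fun p b x" if "x \<in> D" for x
  proof -
    have "exit_fun p c x / exit_fun p b x \<le> M" unfolding M_def
      using \<open>finite D\<close> that pos assms b(1)
      by (intro member_le_sum) (auto intro!: divide_nonneg_nonneg less_imp_le)
    thus ?thesis using pos[OF b(1) that] by (simp add: pos_divide_le_eq)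
  qed
  have upper: "(?K ^^ n) (exit_fun p c) 0 \<le> M * exit_fun p b 0 * b ^ n" for n
  proof -
    have "?K (exit_fun p b) x \<le> b * exit_fun p b x" if "x \<in> D" for x
    proof -
      have "transfer (\<lambda>_. 1) (indicator A) x \<ge> 0" by (simp add: transfer_def)
      thus ?thesis using one_step[OF b(1) that] by linarith
    qed
    hence "(?K ^^ n) (exit_fun p b) 0 \<le> b ^ n * exit_fun p b 0"
      using \<open>b > 0\<close> by (intro transfer_funpow_supersolution[OF closed _ _ zero]) auto
    moreover have "M \<ge> 0" using M[OF zero] pos[OF assms zero] pos[OF b(1) zero]
      by (metis less_le_trans zero_less_mult_pos2 less_imp_le)
    ultimately have "M * (?K ^^ n) (exit_fun p b) 0 \<le> M * (b ^ n * exit_fun p b 0)"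
      by (intro mult_left_mono)
    moreover have "(?K ^^ n) (exit_fun p c) 0 \<le> (?K ^^ n) (\<lambda>x. M * exit_fun p b x) 0"
      by (rule transfer_funpow_mono[OF closed M zero])
    ultimately show ?thesis by (simp add: transfer_funpow_scale mult_ac)
  qed
  have lower: "0 \<le> (?K ^^ n) (exit_fun p c) 0" for n
  proof -
    have "0 * (?K ^^ n) (exit_fun p c) 0 = (?K ^^ n) (\<lambda>x. 0 * exit_fun p c x) 0"
      by (rule transfer_funpow_scale[symmetric])
    also have "\<dots> \<le> (?K ^^ n) (exit_fun p c) 0"
      by (rule transfer_funpow_mono[OF closed _ zero])
        (use pos[OF assms] in \<open>simp add: less_imp_le\<close>)
    finally show ?thesis by simp
  qed
  have "(\<lambda>n. M * exit_fun p b 0 * (b / c) ^ n) \<longlonglongrightarrow> M * exit_fun p b 0 * 0"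
    using \<open>b > 0\<close> \<open>b < c\<close> by (intro tendsto_mult tendsto_const LIMSEQ_realpow_zero) auto
  hence geo: "(\<lambda>n. M * exit_fun p b 0 * (b / c) ^ n) \<longlonglongrightarrow> 0" by simp
  have "(\<lambda>n. (?K ^^ n) (exit_fun p c) 0 / c ^ n) \<longlonglongrightarrow> 0"
  proof (rule real_tendsto_sandwich[OF _ _ tendsto_const geo])
    show "\<forall>\<^sub>F n in sequentially. 0 \<le> (?K ^^ n) (exit_fun p c) 0 / c ^ n"
      using lower \<open>c > 0\<close> by (intro always_eventually allI divide_nonneg_pos) auto
    show "\<forall>\<^sub>F n in sequentially. (?K ^^ n) (exit_fun p c) 0 / c ^ n
        \<le> M * exit_fun p b 0 * (b / c) ^ n"
      using upper \<open>c > 0\<close>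
      by (intro always_eventually allI) (simp add: power_divide divide_right_mono)
  qed
  from Qhit_ln_eq[OF closed zero \<open>c > 0\<close> one_step[OF assms] this]
  have "Qhit A (ln c) = ennreal (exit_fun p c 0)" by blast
  thus ?thesis by (simp add: Q_fin_def A_def exit_fun_def spectral_def)
qed

lemma phi_fin_eq:
  assumes "cheb_positive p c" "spectral p c = exp d"
  shows "phi_fin (2 * Suc p) d = ln c"
  unfolding phi_fin_def Q_fin_inv_def
proof (rule the_equality)
  show Q: "Q_fin (2 * Suc p) (ln c) = ennreal (exp (- d))"
    using Q_fin_ln_eq[OF assms(1)] assms(2) by (simp only: exp_minus inverse_eq_divide)
  show "l = ln c" if "Q_fin (2 * Suc p) l = ennreal (exp (- d))" for l
    using Qhit_inj[of _ l "exp (- d)" "ln c"] that Q unfolding Q_fin_def by auto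
qed

section \<open>Exponential growth rates\<close>

lemma growth_rate:
  fixes Z :: "nat \<Rightarrow> real"
  assumes "0 < A" "0 < c" "\<And>N. A * c ^ N \<le> Z N" "\<And>N. Z N \<le> B * c ^ N"
  shows "(\<lambda>N. ln (Z N) / real N) \<longlonglongrightarrow> ln c"
proof (rule tendsto_sandwich)
  have Bpos: "B > 0" using assms(1) assms(3)[of 0] assms(4)[of 0] by simp
  have rate: "(\<lambda>N. ln b / real N + ln c) \<longlonglongrightarrow> ln c" for b
    using tendsto_add[OF lim_const_over_n[of "ln b"] tendsto_const[of "ln c"]] by simp
  have eq: "ln (b * c ^ N) / real N = ln b / real N + ln c" if "b > 0" "N > 0" for b N
    using that assms(2) by (simp add: ln_mult ln_realpow add_divide_distrib)
  have Zpos: "Z N > 0" for N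
    using assms(3)[of N] mult_pos_pos[OF assms(1) zero_less_power[OF assms(2)]]
    by (rule less_le_trans[rotated])
  show "(\<lambda>N. ln A / real N + ln c) \<longlonglongrightarrow> ln c" "(\<lambda>N. ln B / real N + ln c) \<longlonglongrightarrow> ln c"
    by (rule rate)+
  show "\<forall>\<^sub>F N in sequentially. ln A / real N + ln c \<le> ln (Z N) / real N"
    using eventually_gt_at_top[of 0]
  proof eventually_elim
    case (elim N)
    have "ln (A * c ^ N) \<le> ln (Z N)" using assms(1-3) Zpos by simp
    thus ?case using divide_right_mono[of _ _ "real N"] eq[OF assms(1) elim] by fastforce
  qed
  show "\<forall>\<^sub>F N in sequentially. ln (Z N) / real N \<le> ln B / real N + ln c"
    using eventually_gt_at_top[of 0]
  proof eventually_elim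
    case (elim N)
    have "ln (Z N) \<le> ln (B * c ^ N)" using assms(2,4) Bpos Zpos by simp
    thus ?case using divide_right_mono[of _ _ "real N"] eq[OF Bpos elim] by fastforce
  qed
qed

lemma Zpart_pos: "Zpart T N \<delta> > 0"
proof -
  have "replicate N True \<in> srw_paths N" by (simp add: srw_paths_def)
  thus ?thesis unfolding Zpart_def
    by (intro divide_pos_pos sum_pos finite_srw_paths) auto
qed

lemma Zpart_fixed_period_rate:
  assumes "cheb_positive p c" "spectral p c = exp \<delta>"
  shows "(\<lambda>N. ln (Zpart (2 * Suc p) N \<delta>) / real N) \<longlonglongrightarrow> ln c"
proof -
  let ?T = "2 * Suc p" and ?m = "int (Suc p)"
  define k where "k j = cheb_int (?m - j) c" for j
  note pos = cheb_positiveD[OF assms(1)]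
  have k0: "k 0 = cheb (Suc p) c" by (simp add: k_def cheb_int_def nat_add_distrib del: cheb.simps)
  have kT: "k (int ?T) = k 0"
    using cheb_int_uminus[of ?m c] by (simp add: k_def)
  have k1: "k 1 = cheb p c" by (simp add: k_def cheb_int_def)
  have kT1: "k (int ?T - 1) = cheb p c"
    using cheb_int_uminus[of "int p" c] by (simp add: k_def cheb_int_def)
  have ends: "(k 1 + k (int ?T - 1)) / 2 = c * (exp (- \<delta>) * k 0)"
    using assms(2) pos(1) pos(2)[of p] unfolding k1 kT1 k0
    by (simp add: exp_minus spectral_def field_simps del: cheb.simps)
  have inner: "(k (j + 1) + k (j - 1)) / 2 = c * k j" for j
    using cheb_int_rec[of "?m - j" c] by (simp add: k_def algebra_simps)
  define S where "S = insert (exp (- \<delta>) * k 0) ((\<lambda>n. cheb n c) ` {..Suc p})"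
  have S: "finite S" "S \<noteq> {}" "\<And>s. s \<in> S \<Longrightarrow> s > 0"
    using pos(2) by (auto simp: S_def k0 simp del: cheb.simps)
  have kS: "k j \<in> S" if "0 < j" "j < int ?T" for j
  proof -
    have "nat \<bar>?m - j\<bar> \<le> Suc p" using that by auto
    thus ?thesis by (auto simp: S_def k_def cheb_int_def)
  qed
  have eS: "exp (- \<delta>) * k 0 \<in> S" by (simp add: S_def)
  have mm: "Min S > 0" "Max S > 0" using S by (auto simp: Max_gr_iff)
  show ?thesis
  proof (rule growth_rate)
    show "exp (- \<delta>) * k 0 / Max S * c ^ N \<le> Zpart ?T N \<delta>" for N
      by (rule Zpart_ge_periodic[OF _ _ kT])
        (use pos(1) ends inner mm S(1) eS kS in \<open>auto intro: Max_ge\<close>)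
    show "Zpart ?T N \<delta> \<le> exp (- \<delta>) * k 0 / Min S * c ^ N" for N
      by (rule Zpart_le_periodic[OF _ _ kT])
        (use pos(1) ends inner mm S(1) eS kS in \<open>auto intro: Min_le\<close>)
    show "exp (- \<delta>) * k 0 / Max S > 0" using S(3)[OF eS] mm(2) by (rule divide_pos_pos)
  qed (rule pos(1))
qed

lemma Zpart_attractive_lower:
  assumes "\<delta> \<ge> 0" "T \<ge> 2"
  shows "exp (- \<delta>) * cosh (decay \<delta>) ^ N \<le> Zpart T N \<delta>"
proof -
  define a where "a = decay \<delta>"
  define k where "k j = max (exp (- a * real_of_int j)) (exp (- a * (real T - real_of_int j)))" for j
  have a: "a \<ge> 0" "exp (- a) = cosh a * exp (- \<delta>)"
    using cosh_decay[OF assms(1)] by (simp_all add: a_def)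
  have k0: "k 0 = 1" using a(1) by (simp add: k_def)
  have kT: "k (int T) = k 0" by (simp add: k_def max.commute)
  have "exp (- \<delta>) * k 0 / 1 * cosh a ^ N \<le> Zpart T N \<delta>"
  proof (rule Zpart_ge_periodic[OF assms(2) _ kT])
    have "k 1 \<ge> exp (- a)" "k (int T - 1) \<ge> exp (- a)" by (simp_all add: k_def)
    thus "cosh a * (exp (- \<delta>) * k 0) \<le> (k 1 + k (int T - 1)) / 2" using a(2) k0 by simp
    show "cosh a * k j \<le> (k (j + 1) + k (j - 1)) / 2" for j
    proof -
      have "2 * cosh a * exp (- a * j) = exp (- a * (j - 1)) + exp (- a * (j + 1))"
        using two_cosh_mult_exp[of a "- a * j"] by (simp add: algebra_simps)
      also have "\<dots> \<le> k (j - 1) + k (j + 1)" unfolding k_def by (intro add_mono) auto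
      finally have 1: "cosh a * exp (- a * j) \<le> (k (j + 1) + k (j - 1)) / 2" by simp
      have "2 * cosh a * exp (- a * (real T - j))
          = exp (- a * (real T - (j + 1))) + exp (- a * (real T - (j - 1)))"
        using two_cosh_mult_exp[of a "- a * (real T - j)"] by (simp add: algebra_simps)
      also have "\<dots> \<le> k (j + 1) + k (j - 1)" unfolding k_def by (intro add_mono) auto
      finally have 2: "cosh a * exp (- a * (real T - j)) \<le> (k (j + 1) + k (j - 1)) / 2" by simp
      from 1 2 show ?thesis by (simp only: k_def[of j] max_def split: if_split) simp
    qed
    show "k j \<le> 1" if "0 < j" "j < int T" for j
    proof -
      have "real_of_int j > 0" "real_of_int j < real T" using that by linarith+
      thus ?thesis using a(1) by (simp add: k_def)
    qed
    show "exp (- \<delta>) * k 0 \<le> 1" using assms(1) k0 by simp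
    show "0 \<le> cosh a" by simp
  qed simp
  thus ?thesis using k0 by (simp add: a_def)
qed

lemma Zpart_attractive_upper:
  assumes "\<delta> \<ge> 0" "T \<ge> 2" "a > 0" "\<eta> > 0"
    and gap: "exp (- a) + exp (- a * (real T - 1)) + \<eta> \<le> cosh a * exp (- \<delta>)"
  shows "Zpart T N \<delta> \<le> (2 + \<eta>) / \<eta> * cosh a ^ N"
proof -
  define k where "k j = exp (- a * real_of_int j) + exp (- a * (real T - real_of_int j)) + \<eta>" for j
  have kT: "k (int T) = k 0" by (simp add: k_def)
  have k_ge: "k j \<ge> \<eta>" for j by (simp add: k_def)
  have k0: "1 \<le> k 0" "k 0 \<le> 2 + \<eta>" using assms(3,4) by (simp_all add: k_def)
  have c: "cosh a \<ge> 1" by (rule cosh_real_ge_1)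
  have "Zpart T N \<delta> \<le> exp (- \<delta>) * k 0 / (exp (- \<delta>) * \<eta>) * cosh a ^ N"
  proof (rule Zpart_le_periodic[OF assms(2) _ kT])
    have "(k 1 + k (int T - 1)) / 2 = exp (- a) + exp (- a * (real T - 1)) + \<eta>"
      by (simp add: k_def)
    also have "\<dots> \<le> cosh a * exp (- \<delta>) * 1" using gap by simp
    also have "\<dots> \<le> cosh a * exp (- \<delta>) * k 0" using k0 c by (intro mult_left_mono) auto
    finally show "(k 1 + k (int T - 1)) / 2 \<le> cosh a * (exp (- \<delta>) * k 0)" by (simp add: mult.assoc)
    show "(k (j + 1) + k (j - 1)) / 2 \<le> cosh a * k j" for j
    proof -
      have "2 * cosh a * exp (- a * j) = exp (- a * (j - 1)) + exp (- a * (j + 1))"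
        using two_cosh_mult_exp[of a "- a * j"] by (simp add: algebra_simps)
      moreover have "2 * cosh a * exp (- a * (real T - j))
          = exp (- a * (real T - (j + 1))) + exp (- a * (real T - (j - 1)))"
        using two_cosh_mult_exp[of a "- a * (real T - j)"] by (simp add: algebra_simps)
      moreover have "\<eta> \<le> cosh a * \<eta>" using c assms(4) by simp
      ultimately show ?thesis by (simp add: k_def distrib_left)
    qed
    show "exp (- \<delta>) * \<eta> \<le> k j" for j
    proof -
      have "exp (- \<delta>) * \<eta> \<le> 1 * \<eta>" using assms(1,4) by (intro mult_right_mono) auto
      thus ?thesis using k_ge[of j] by linarith
    qed
    show "exp (- \<delta>) * \<eta> \<le> exp (- \<delta>) * k 0" using k_ge by simp
    show "0 < exp (- \<delta>) * \<eta>" "0 \<le> cosh a" using assms(4) by simp_all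
  qed
  also have "exp (- \<delta>) * k 0 / (exp (- \<delta>) * \<eta>) = k 0 / \<eta>" by simp
  also have "k 0 / \<eta> * cosh a ^ N \<le> (2 + \<eta>) / \<eta> * cosh a ^ N"
    using k0 assms(4) by (intro mult_right_mono divide_right_mono) auto
  finally show ?thesis .
qed

lemma Zpart_repulsive_upper:
  assumes "\<delta> \<le> 0"
  shows "Zpart T N \<delta> \<le> 1"
proof -
  have "Zpart T N \<delta> \<le> 1 / 1 * 1 ^ N"
    using assms by (intro Zpart_le_supersolution[where h = "\<lambda>_. 1"])
      (auto simp: transfer_def pin_weight_def)
  thus ?thesis by simp
qed

lemma Zpart_repulsive_lower:
  assumes "\<delta> \<le> 0" "T \<ge> 2"
  shows "(1 - 1 / (real T - 1)) ^ N / real T ^ 2 \<le> Zpart T N \<delta>"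
proof -
  define c where "c = 1 - 1 / (real T - 1)"
  define q where "q j = real_of_int j * (real T - real_of_int j)" for j
  define k where "k j = (if j = 0 \<or> j = int T then exp \<delta> * (real T - 1) else q j)" for j
  have T: "real T - 1 \<ge> 1" using assms(2) by linarith
  have c: "0 \<le> c" "c \<le> 1" "c * (real T - 1) = real T - 2" using T by (auto simp: c_def field_simps)
  have kq: "q j \<le> k j" for j using T by (auto simp: k_def q_def)
  have k0: "exp (- \<delta>) * k 0 = real T - 1" by (simp add: k_def exp_minus)
  have TT: "real T - 1 \<le> real T ^ 2" "0 < real T ^ 2"
    using T self_le_power[of "real T" 2] by (linarith, simp)
  have "exp (- \<delta>) * k 0 / real T ^ 2 * c ^ N \<le> Zpart T N \<delta>"
  proof (rule Zpart_ge_periodic[OF assms(2) c(1)])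
    show "k (int T) = k 0" by (simp add: k_def)
    have "q 1 = real T - 1" "q (int T - 1) = real T - 1" by (simp_all add: q_def)
    hence "real T - 1 \<le> (k 1 + k (int T - 1)) / 2" using kq[of 1] kq[of "int T - 1"] by simp
    thus "c * (exp (- \<delta>) * k 0) \<le> (k 1 + k (int T - 1)) / 2" unfolding k0 using c(3) by simp
    fix j assume j: "0 < j" "j < int T"
    have jr: "1 \<le> real_of_int j" "real_of_int j \<le> real T - 1" using j by linarith+
    have kj: "k j = q j" using j by (simp add: k_def)
    have "(real_of_int j - 1) * (real T - 1 - real_of_int j) \<ge> 0" using jr by simp
    hence "real T - 1 \<le> q j" by (simp add: q_def algebra_simps)
    hence "1 \<le> q j / (real T - 1)" using T by simp
    hence "c * q j \<le> q j - 1" by (simp add: c_def algebra_simps)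
    also have "\<dots> = (q (j + 1) + q (j - 1)) / 2" by (simp add: q_def algebra_simps)
    also have "\<dots> \<le> (k (j + 1) + k (j - 1)) / 2" using kq[of "j + 1"] kq[of "j - 1"] by simp
    finally show "c * k j \<le> (k (j + 1) + k (j - 1)) / 2" unfolding kj .
    have "q j \<le> real T * real T" unfolding q_def using jr T by (intro mult_mono) auto
    thus "k j \<le> real T ^ 2" by (simp add: kj power2_eq_square)
  qed (use k0 TT in auto)
  moreover have "1 * c ^ N \<le> (real T - 1) * c ^ N" using T c(1) by (intro mult_right_mono) auto
  hence "c ^ N / real T ^ 2 \<le> (real T - 1) / real T ^ 2 * c ^ N"
    using divide_right_mono[of "c ^ N" _ "real T ^ 2"] by simp
  ultimately show ?thesis unfolding k0 c_def by linarith
qed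

lemma growth_rate_repulsive:
  assumes "\<delta> \<le> 0" "\<And>N. N \<ge> 2 \<Longrightarrow> 2 \<le> T N \<and> T N \<le> N" "filterlim T at_top sequentially"
  shows "(\<lambda>N. ln (Zpart (T N) N \<delta>) / real N) \<longlonglongrightarrow> 0"
proof (rule tendsto_sandwich)
  let ?c = "\<lambda>N. 1 - 1 / (real (T N) - 1)"
  have "filterlim (\<lambda>N. real (T N)) at_top sequentially"
    using filterlim_compose[OF filterlim_real_sequentially assms(3)] .
  hence "filterlim (\<lambda>N. -1 + real (T N)) at_top sequentially"
    by (rule filterlim_tendsto_add_at_top[OF tendsto_const])
  hence "(\<lambda>N. inverse (-1 + real (T N))) \<longlonglongrightarrow> 0"
    by (rule tendsto_inverse_0_at_top)
  hence "(\<lambda>N. 1 - inverse (-1 + real (T N))) \<longlonglongrightarrow> 1 - 0"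
    by (intro tendsto_diff tendsto_const)
  hence "?c \<longlonglongrightarrow> 1" by (simp add: inverse_eq_divide)
  hence "(\<lambda>N. ln (?c N)) \<longlonglongrightarrow> ln 1" by (intro tendsto_ln) auto
  moreover have "(\<lambda>N. ln (real N) / real N) \<longlonglongrightarrow> 0" by (rule lim_ln_over_n)
  ultimately have "(\<lambda>N. ln (?c N) - 2 * (ln (real N) / real N)) \<longlonglongrightarrow> ln 1 - 2 * 0"
    by (intro tendsto_diff tendsto_mult tendsto_const)
  thus "(\<lambda>N. ln (?c N) - 2 * (ln (real N) / real N)) \<longlonglongrightarrow> 0" by simp
  have "\<forall>\<^sub>F N in sequentially. T N \<ge> 3" using assms(3) by (auto simp: filterlim_at_top)
  thus "\<forall>\<^sub>F N in sequentially. ln (?c N) - 2 * (ln (real N) / real N)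
      \<le> ln (Zpart (T N) N \<delta>) / real N"
    using eventually_ge_at_top[of 2]
  proof eventually_elim
    case (elim N)
    have c: "?c N > 0" using elim by simp
    have TN: "0 < real (T N)" "real (T N) \<le> real N" using assms(2)[OF elim(2)] by auto
    have "?c N ^ N / real N ^ 2 \<le> ?c N ^ N / real (T N) ^ 2"
      using c TN by (intro divide_left_mono power_mono mult_pos_pos zero_less_power) auto
    also have "\<dots> \<le> Zpart (T N) N \<delta>"
      using Zpart_repulsive_lower[OF assms(1)] assms(2)[OF elim(2)] by blast
    finally have "ln (?c N ^ N / real N ^ 2) \<le> ln (Zpart (T N) N \<delta>)"
      using c elim Zpart_pos by (subst ln_le_cancel_iff) auto
    moreover have "ln (?c N ^ N / real N ^ 2) = real N * ln (?c N) - 2 * ln (real N)"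
      using c elim by (subst ln_div) (auto simp: ln_realpow)
    ultimately have "(real N * ln (?c N) - 2 * ln (real N)) / real N \<le> ln (Zpart (T N) N \<delta>) / real N"
      by (intro divide_right_mono) auto
    thus ?case using elim by (simp add: diff_divide_distrib)
  qed
  show "\<forall>\<^sub>F N in sequentially. ln (Zpart (T N) N \<delta>) / real N \<le> 0"
    using Zpart_repulsive_upper[OF assms(1)] Zpart_pos
    by (intro always_eventually allI divide_nonpos_nonneg) auto
qed (rule tendsto_const)

lemma growth_rate_attractive:
  assumes "\<delta> \<ge> 0" "\<And>N. N \<ge> 2 \<Longrightarrow> 2 \<le> T N" "filterlim T at_top sequentially"
  shows "(\<lambda>N. ln (Zpart (T N) N \<delta>) / real N) \<longlonglongrightarrow> ln (cosh (decay \<delta>))"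
proof (rule order_tendstoI)
  let ?Z = "\<lambda>N. Zpart (T N) N \<delta>"
  have rate: "(\<lambda>N. ln b / real N + l) \<longlonglongrightarrow> l" for b l :: real
    using tendsto_add[OF lim_const_over_n[of "ln b"] tendsto_const[of l]] by simp
  have eq: "ln (b * cosh a ^ N) / real N = ln b / real N + ln (cosh a)" if "b > 0" "N > 0" for b a N
    using that by (simp add: ln_mult ln_realpow add_divide_distrib)
  fix y
  {
    assume "y < ln (cosh (decay \<delta>))"
    hence "\<forall>\<^sub>F N in sequentially. y < ln (exp (- \<delta>)) / real N + ln (cosh (decay \<delta>))"
      by (rule order_tendstoD(1)[OF rate])
    thus "\<forall>\<^sub>F N in sequentially. y < ln (?Z N) / real N"
      using eventually_ge_at_top[of 2]
    proof eventually_elim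
      case (elim N)
      have "ln (exp (- \<delta>) * cosh (decay \<delta>) ^ N) \<le> ln (?Z N)"
        using Zpart_attractive_lower[OF assms(1)] assms(2)[OF elim(2)] Zpart_pos
        by (subst ln_le_cancel_iff) auto
      hence "ln (exp (- \<delta>) * cosh (decay \<delta>) ^ N) / real N \<le> ln (?Z N) / real N"
        by (rule divide_right_mono) simp
      thus ?case using elim eq[of "exp (- \<delta>)" N "decay \<delta>"] by simp
    qed
  next
    assume y: "ln (cosh (decay \<delta>)) < y"
    have "isCont (\<lambda>a::real. ln (cosh a)) (decay \<delta>)" by (intro continuous_intros) auto
    hence "((\<lambda>a. ln (cosh a)) \<longlongrightarrow> ln (cosh (decay \<delta>))) (at_right (decay \<delta>))"
      by (simp add: isCont_def filterlim_at_split)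
    hence "\<forall>\<^sub>F a in at_right (decay \<delta>). ln (cosh a) < y"
      using y by (rule order_tendstoD(2))
    moreover have "\<forall>\<^sub>F a in at_right (decay \<delta>). a > decay \<delta>"
      by (simp add: eventually_at_filter)
    ultimately have "\<forall>\<^sub>F a in at_right (decay \<delta>). ln (cosh a) < y \<and> a > decay \<delta>"
      by (rule eventually_conj)
    then obtain a where a: "ln (cosh a) < y" "a > decay \<delta>"
      using eventually_happens'[OF trivial_limit_at_right_real] by blast
    note d = cosh_decay[OF assms(1)]
    have "a > 0" using a(2) d(1) by simp
    have "cosh (decay \<delta>) < cosh a" using a(2) d(1) by (intro cosh_real_strict_mono)
    hence "cosh (decay \<delta>) * exp (- \<delta>) < cosh a * exp (- \<delta>)" by simp
    moreover have "exp (- a) < exp (- decay \<delta>)" using a(2) by simp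
    ultimately have gap: "exp (- a) < cosh a * exp (- \<delta>)" using d(2) by linarith
    define \<eta> where "\<eta> = (cosh a * exp (- \<delta>) - exp (- a)) / 2"
    have "\<eta> > 0" using gap by (simp add: \<eta>_def)
    have "filterlim (\<lambda>N. real (T N)) at_top sequentially"
      using filterlim_compose[OF filterlim_real_sequentially assms(3)] .
    hence "\<forall>\<^sub>F N in sequentially. real (T N) \<ge> 1 + (- ln \<eta>) / a"
      by (auto simp: filterlim_at_top)
    moreover have "\<forall>\<^sub>F N in sequentially. ln ((2 + \<eta>) / \<eta>) / real N + ln (cosh a) < y"
      using a(1) by (rule order_tendstoD(2)[OF rate])
    ultimately show "\<forall>\<^sub>F N in sequentially. ln (?Z N) / real N < y"
      using eventually_ge_at_top[of 2]
    proof eventually_elim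
      case (elim N)
      have "- ln \<eta> \<le> a * (real (T N) - 1)"
        using elim(1) \<open>a > 0\<close> by (simp add: field_simps)
      hence "exp (- a * (real (T N) - 1)) \<le> exp (ln \<eta>)" by (subst exp_le_cancel_iff) linarith
      hence "exp (- a * (real (T N) - 1)) \<le> \<eta>" using \<open>\<eta> > 0\<close> by simp
      moreover have "exp (- a) + 2 * \<eta> = cosh a * exp (- \<delta>)" unfolding \<eta>_def by argo
      ultimately have "exp (- a) + exp (- a * (real (T N) - 1)) + \<eta> \<le> cosh a * exp (- \<delta>)"
        by linarith
      hence "?Z N \<le> (2 + \<eta>) / \<eta> * cosh a ^ N"
        using assms(1,2) elim(3) \<open>a > 0\<close> \<open>\<eta> > 0\<close> by (intro Zpart_attractive_upper) auto
      hence "ln (?Z N) \<le> ln ((2 + \<eta>) / \<eta> * cosh a ^ N)"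
        using Zpart_pos[of "T N" N \<delta>] by (subst ln_le_cancel_iff) auto
      hence "ln (?Z N) / real N \<le> ln ((2 + \<eta>) / \<eta> * cosh a ^ N) / real N"
        by (rule divide_right_mono) simp
      thus ?case using elim eq[of "(2 + \<eta>) / \<eta>" N a] \<open>\<eta> > 0\<close> by simp
    qed
  }
qed

lemma growth_rate_infinite_period:
  assumes "\<And>N. N \<ge> 2 \<Longrightarrow> 2 \<le> T N \<and> T N \<le> N" "filterlim T at_top sequentially"
  shows "(\<lambda>N. ln (Zpart (T N) N \<delta>) / real N) \<longlonglongrightarrow> phi_inf \<delta>"
proof (cases "\<delta> \<ge> 0")
  case True
  thus ?thesis
    using growth_rate_attractive[OF True, of T] assms by (simp add: phi_inf_eq ln_cosh_decay)
next
  case False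
  thus ?thesis using growth_rate_repulsive[of \<delta> T] assms by (simp add: phi_inf_eq)
qed

section \<open>Real analyticity\<close>

lemma real_analytic_on_holomorphic:
  assumes "\<And>x. x \<in> S \<Longrightarrow> \<exists>r>0. \<exists>F. F holomorphic_on ball (of_real x) r \<and>
    (\<forall>y. \<bar>y - x\<bar> < r \<longrightarrow> F (of_real y) = of_real (f y))"
  shows "real_analytic_on f S"
  unfolding real_analytic_on_def
proof
  fix x assume "x \<in> S"
  then obtain r F where r: "r > 0" and F: "F holomorphic_on ball (of_real x) r"
    and eq: "\<And>y. \<bar>y - x\<bar> < r \<Longrightarrow> F (of_real y) = of_real (f y)"
    using assms by blast
  define a where "a n = (deriv ^^ n) F (of_real x) / fact n" for n
  have "(\<lambda>n. Re (a n) * (y - x) ^ n) sums f y" if y: "\<bar>y - x\<bar> < r" for y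
  proof -
    have "complex_of_real y \<in> ball (of_real x) r"
      using y by (simp add: dist_of_real dist_real_def abs_minus_commute)
    from sums_Re[OF holomorphic_power_series[OF F this]]
    have "(\<lambda>n. Re (a n * (of_real y - of_real x) ^ n)) sums f y"
      by (simp add: eq[OF y] a_def)
    moreover have "Re (a n * (of_real y - of_real x) ^ n) = Re (a n) * (y - x) ^ n" for n
    proof -
      have "(complex_of_real y - of_real x) ^ n = of_real ((y - x) ^ n)" by simp
      thus ?thesis by (simp only: Re_complex_of_real Im_complex_of_real times_complex.sel)
    qed
    ultimately show ?thesis by simp
  qed
  thus "\<exists>r>0. \<exists>c. \<forall>y. \<bar>y - x\<bar> < r \<longrightarrow> (\<lambda>n. c n * (y - x) ^ n) sums f y"
    using r by (intro exI[of _ r] conjI exI[of _ "\<lambda>n. Re (a n)"]) auto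
qed

lemma real_analytic_phi_inf: "real_analytic_on phi_inf (UNIV - {0})"
proof (rule real_analytic_on_holomorphic)
  fix x :: real assume "x \<in> UNIV - {0}"
  then consider "x < 0" | "x > 0" by fastforce
  thus "\<exists>r>0. \<exists>F. F holomorphic_on ball (of_real x) r \<and>
    (\<forall>y. \<bar>y - x\<bar> < r \<longrightarrow> F (of_real y) = of_real (phi_inf y))"
  proof cases
    case 1
    thus ?thesis by (intro exI[of _ "- x"] conjI exI[of _ "\<lambda>_. 0"]) (auto simp: phi_inf_eq)
  next
    case 2
    define F where "F z = z / 2 - Ln (2 - exp (- z)) / 2" for z
    have "2 - exp (- z) \<notin> \<real>\<^sub>\<le>\<^sub>0" if "z \<in> ball (complex_of_real x) x" for z
    proof -
      have "\<bar>Re (of_real x - z)\<bar> < x"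
        using abs_Re_le_cmod[of "of_real x - z"] that by (simp add: dist_norm)
      hence "Re z > 0" by simp
      hence "cmod (exp (- z)) < 1" by simp
      hence "Re (exp (- z)) < 1" using complex_Re_le_cmod[of "exp (- z)"] by linarith
      hence "Re (2 - exp (- z)) > 0" by simp
      thus ?thesis using complex_nonpos_Reals_iff by force
    qed
    hence "F holomorphic_on ball (of_real x) x"
      unfolding F_def by (intro holomorphic_intros) auto
    moreover have "F (of_real y) = of_real (phi_inf y)" if "\<bar>y - x\<bar> < x" for y
    proof -
      have "y > 0" using that by linarith
      hence p: "2 - exp (- y) > 0" by (smt (verit) exp_le_one_iff)
      have "2 - exp (- complex_of_real y) = of_real (2 - exp (- y))"
        by (simp flip: exp_of_real)
      hence "Ln (2 - exp (- complex_of_real y)) = of_real (ln (2 - exp (- y)))"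
        using p by (simp only: Ln_of_real)
      thus ?thesis using \<open>y > 0\<close> p by (simp add: F_def phi_inf_eq ln_sqrt)
    qed
    ultimately show ?thesis using 2 by blast
  qed
qed

lemma has_field_derivative_spectral:
  fixes z :: "'a::real_normed_field"
  assumes "cheb p z \<noteq> 0"
  shows "(spectral p has_field_derivative
    (cheb (Suc p) z * cheb p z + z * (cheb_deriv (Suc p) z * cheb p z - cheb (Suc p) z * cheb_deriv p z))
      / (cheb p z)\<^sup>2) (at z)"
proof -
  have "((\<lambda>z. z * cheb (Suc p) z / cheb p z) has_field_derivative
    ((1 * cheb (Suc p) z + cheb_deriv (Suc p) z * z) * cheb p z - z * cheb (Suc p) z * cheb_deriv p z)
      / (cheb p z * cheb p z)) (at z)"
    by (intro DERIV_divide DERIV_mult DERIV_ident has_field_derivative_cheb assms)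
  thus ?thesis
    unfolding spectral_def[abs_def]
    by (simp add: algebra_simps power2_eq_square del: cheb.simps cheb_deriv.simps)
qed

lemma spectral_of_real: "spectral p (of_real c) = (of_real (spectral p c) :: complex)"
  by (simp add: spectral_def cheb_of_real del: cheb.simps)

lemma real_analytic_phi_fin: "real_analytic_on (phi_fin (2 * Suc p)) UNIV"
proof (rule real_analytic_on_holomorphic)
  fix x :: real
  obtain c where c: "\<And>d. cheb_positive p (c d)" "\<And>d. spectral p (c d) = exp d"
    using spectral_surj[of "exp _" p] by (metis exp_gt_zero)
  define c0 where "c0 = c x"
  note pos = cheb_positiveD[OF c(1)]
  define S where "S = {z. Re z > 0} \<inter> {z::complex. cheb p z \<noteq> 0}"
  let ?F = "spectral p :: complex \<Rightarrow> complex"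
  have cont: "continuous_on UNIV (cheb p :: complex \<Rightarrow> complex)"
    by (intro continuous_at_imp_continuous_on ballI DERIV_isCont[OF has_field_derivative_cheb])
  have "open S" unfolding S_def
    by (intro open_Int open_halfspace_Re_gt open_Collect_neq cont continuous_on_const)
  have holF: "?F holomorphic_on S"
    unfolding holomorphic_on_open[OF \<open>open S\<close>]
    using has_field_derivative_spectral by (auto simp: S_def)
  have c0S: "complex_of_real c0 \<in> S"
    using pos(1)[of x] pos(2)[of p x] by (simp add: S_def c0_def cheb_of_real)
  have dF: "deriv ?F (of_real c0) \<noteq> 0"
  proof -
    have "cheb p (complex_of_real c0) \<noteq> 0" using c0S by (simp add: S_def)
    from DERIV_imp_deriv[OF has_field_derivative_spectral[OF this]]
    have "deriv ?F (of_real c0) = of_real ((cheb (Suc p) c0 * cheb p c0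
        + c0 * (cheb_deriv (Suc p) c0 * cheb p c0 - cheb (Suc p) c0 * cheb_deriv p c0))
        / (cheb p c0)\<^sup>2)"
      (is "_ = of_real (?num / _)")
      by (simp add: cheb_of_real cheb_deriv_of_real del: cheb.simps cheb_deriv.simps)
    moreover have "0 < ?num"
      using pos(1)[of x] pos(2)[of _ x] unfolding c0_def
      by (intro add_pos_pos mult_pos_pos cheb_wronskian_pos) auto
    moreover have "(cheb p c0)\<^sup>2 > 0" using pos(2)[of p x] by (simp add: c0_def)
    ultimately show ?thesis using divide_pos_pos by (metis of_real_eq_0_iff less_irrefl)
  qed
  obtain r where r: "r > 0" "ball (of_real c0) r \<subseteq> S" "open (?F ` ball (of_real c0) r)"
    "inj_on ?F (ball (of_real c0) r)"
    by (rule has_complex_derivative_locally_invertible[OF holF c0S \<open>open S\<close> dF])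
  let ?B = "ball (complex_of_real c0) r"
  obtain g where g: "g holomorphic_on (?F ` ?B)" "\<And>z. z \<in> ?B \<Longrightarrow> g (?F z) = z"
    by (rule holomorphic_has_inverse[OF holomorphic_on_subset[OF holF r(2)] open_ball r(4)]) metis
  have "open (exp -` (?F ` ?B))"
    by (intro open_vimage r(3) continuous_intros)
  moreover have "?F (of_real c0) = exp (of_real x)"
    by (simp add: spectral_of_real c0_def c(2) exp_of_real)
  hence "exp (of_real x) \<in> ?F ` ?B" using r(1) by (intro rev_image_eqI[of "of_real c0"]) auto
  hence "of_real x \<in> exp -` (?F ` ?B)" by (rule vimageI2)
  ultimately obtain s where s: "s > 0" "ball (of_real x) s \<subseteq> exp -` (?F ` ?B)"
    by (rule openE)
  define h where "h z = Ln (g (exp z))" for z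
  have gB: "g w \<in> S" if "w \<in> ?F ` ?B" for w using that g(2) r(2) by auto
  have "(\<lambda>z. g (exp z)) holomorphic_on ball (of_real x) s"
    using holomorphic_on_compose_gen[OF holomorphic_on_exp g(1), of "ball (of_real x) s"] s(2)
    by (auto simp: o_def)
  moreover have "g (exp z) \<notin> \<real>\<^sub>\<le>\<^sub>0" if "z \<in> ball (of_real x) s" for z
  proof -
    have "g (exp z) \<in> S" using gB that s(2) by blast
    thus ?thesis using complex_nonpos_Reals_iff by (force simp: S_def)
  qed
  ultimately have holh: "h holomorphic_on ball (of_real x) s"
    unfolding h_def by (intro holomorphic_on_Ln')
  define b1 where "b1 = max (c0 - r / 2) (c (x - 1))"
  have "c (x - 1) < c0"
  proof (rule ccontr)
    assume "\<not> c (x - 1) < c0"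
    hence "spectral p c0 \<le> spectral p (c (x - 1))"
      using spectral_strict_mono[OF c(1)[of x], of "c (x - 1)"] unfolding c0_def
      by (cases "c (x - 1) = c x") auto
    thus False by (simp add: c0_def c(2))
  qed
  hence b1: "b1 < c0" "c0 - r < b1" using r(1) by (auto simp: b1_def)
  have b1p: "cheb_positive p b1"
    using cheb_ratio_mono[OF c(1)[of "x - 1"], of b1] by (simp add: b1_def)
  define b2 where "b2 = c0 + r / 2"
  have b2: "c0 < b2" "b2 < c0 + r" using r(1) by (auto simp: b2_def)
  have b2p: "cheb_positive p b2"
    using cheb_ratio_mono[OF c(1)[of x], of b2] b2(1) by (simp add: c0_def)
  note sp = cheb_positiveD(3)[OF b1p] cheb_positiveD(3)[OF b2p]
  have "spectral p b1 < exp x" "exp x < spectral p b2"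
    using spectral_strict_mono[OF b1p b1(1)] spectral_strict_mono[OF c(1)[of x], of b2] b2(1)
    by (auto simp: c0_def c(2))
  hence "ln (spectral p b1) < ln (exp x)" "ln (exp x) < ln (spectral p b2)"
    using sp by (simp_all only: ln_less_cancel_iff exp_gt_zero)
  hence l: "ln (spectral p b1) < x" "x < ln (spectral p b2)" by simp_all
  define t where "t = min s (min (x - ln (spectral p b1)) (ln (spectral p b2) - x))"
  have "t > 0" using s(1) l by (simp add: t_def)
  moreover have "h holomorphic_on ball (of_real x) t"
    using holh by (rule holomorphic_on_subset) (auto simp: t_def)
  moreover have "h (of_real y) = of_real (phi_fin (2 * Suc p) y)" if y: "\<bar>y - x\<bar> < t" for y
  proof -
    have "ln (spectral p b1) < y" "y < ln (spectral p b2)" using y by (auto simp: t_def)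
    hence "spectral p b1 < exp y" "exp y < spectral p b2"
      using sp by (metis exp_less_cancel_iff exp_ln)+
    hence "spectral p b1 < spectral p (c y)" "spectral p (c y) < spectral p b2" by (simp_all add: c(2))
    hence "b1 < c y" "c y < b2"
      using spectral_strict_mono[OF c(1)[of y], of b1] spectral_strict_mono[OF b2p, of "c y"]
      by (metis linorder_neqE_linordered_idom less_asym)+
    hence "\<bar>c y - c0\<bar> < r" using b1 b2 by linarith
    hence "complex_of_real (c y) \<in> ?B" by (simp add: dist_of_real dist_real_def abs_minus_commute)
    from g(2)[OF this] have "g (exp (of_real y)) = of_real (c y)"
      by (simp add: spectral_of_real c(2) exp_of_real)
    thus ?thesis using pos(1)[of y] phi_fin_eq[OF c(1,2)] by (simp add: h_def Ln_of_real)
  qed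
  ultimately show "\<exists>r>0. \<exists>F. F holomorphic_on ball (of_real x) r \<and>
    (\<forall>y. \<bar>y - x\<bar> < r \<longrightarrow> F (of_real y) = of_real (phi_fin (2 * Suc p) y))"
    by blast
qed

lemma growth_rate_finite_period:
  assumes "\<And>N. N \<ge> 2 \<Longrightarrow> even (T N) \<and> 2 \<le> T N" "T \<longlonglongrightarrow> t"
  shows "(\<lambda>N. ln (Zpart (T N) N \<delta>) / real N) \<longlonglongrightarrow> phi_fin t \<delta>"
    and "real_analytic_on (phi_fin t) UNIV"
proof -
  have ev: "\<forall>\<^sub>F N in sequentially. T N = t" using assms(2) by (simp add: tendsto_discrete)
  hence "\<forall>\<^sub>F N in sequentially. T N = t \<and> N \<ge> 2"
    using eventually_ge_at_top[of 2] by (rule eventually_conj)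
  then obtain N where "T N = t" "N \<ge> 2" by (auto simp: eventually_sequentially)
  hence "even t" "2 \<le> t" using assms(1) by auto
  then obtain p where t: "t = 2 * Suc p" by (metis evenE not0_implies_Suc mult_0_right not_numeral_le_zero)
  show "real_analytic_on (phi_fin t) UNIV" unfolding t by (rule real_analytic_phi_fin)
  obtain c where c: "cheb_positive p c" "spectral p c = exp \<delta>"
    using spectral_surj[of "exp \<delta>" p] by auto
  have "(\<lambda>N. ln (Zpart t N \<delta>) / real N) \<longlonglongrightarrow> phi_fin t \<delta>"
    unfolding t phi_fin_eq[OF c] by (rule Zpart_fixed_period_rate[OF c])
  moreover have "\<forall>\<^sub>F N in sequentially. ln (Zpart t N \<delta>) / real N = ln (Zpart (T N) N \<delta>) / real N"
    using ev by eventually_elim simp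
  ultimately show "(\<lambda>N. ln (Zpart (T N) N \<delta>) / real N) \<longlonglongrightarrow> phi_fin t \<delta>"
    by (rule Lim_transform_eventually)
qed

theorem theorem1:
  fixes \<delta> :: real and T :: "nat \<Rightarrow> nat"
  assumes T_even: "\<And>N. N \<ge> 2 \<Longrightarrow> even (T N) \<and> 2 \<le> T N \<and> T N \<le> N"
    and T_lim: "(\<exists>t. T \<longlonglongrightarrow> t) \<or> filterlim T at_top sequentially"
  shows "(\<exists>L. (\<lambda>N. ln (Zpart (T N) N \<delta>) / real N) \<longlonglongrightarrow> L)
    \<and> (\<forall>t. T \<longlonglongrightarrow> t \<longrightarrow>
          (\<lambda>N. ln (Zpart (T N) N \<delta>) / real N) \<longlonglongrightarrow> phi_fin t \<delta>
          \<and> real_analytic_on (phi_fin t) UNIV)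
    \<and> (filterlim T at_top sequentially \<longrightarrow>
          (\<lambda>N. ln (Zpart (T N) N \<delta>) / real N) \<longlonglongrightarrow> phi_inf \<delta>
          \<and> real_analytic_on phi_inf (UNIV - {0})
          \<and> (\<forall>d. phi_inf d = (if d \<ge> 0 then d / 2 - ln (sqrt (2 - exp (- d))) else 0)))"
proof -
  have fin: "(\<lambda>N. ln (Zpart (T N) N \<delta>) / real N) \<longlonglongrightarrow> phi_fin t \<delta>"
    "real_analytic_on (phi_fin t) UNIV" if "T \<longlonglongrightarrow> t" for t
    using growth_rate_finite_period[OF _ that] T_even by blast+
  have inf: "(\<lambda>N. ln (Zpart (T N) N \<delta>) / real N) \<longlonglongrightarrow> phi_inf \<delta>"
    if "filterlim T at_top sequentially"
    using growth_rate_infinite_period[OF _ that] T_even by blast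
  show ?thesis using T_lim fin inf real_analytic_phi_inf phi_inf_eq by blast
qed

end
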